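(* Let $f(z,w)=(\lambda z,w^d+c(z))$ on $B(0,r_0)\times\mathbb{C}$ be as in the context, and assume that $f_0(w)=w^d+c(0)$ has no attracting nor superattracting cycle in $\mathbb{C}$. Given $0<\lambda_0<1$ there exists $C=C(\lambda_0)>0$ such that for every $n\ge 1$ and every tame orbit $\{x_i=(z_i,w_i)\}_{0\le i\le n}$ of $f$, $$|Df^{n}(x_0)(v)|\ \ge\ C\lambda_0^n\min_{0\le i\le n-1}|w_i|^{d-1}.$$ Moreover, if $|w_n|\le|w_j|$ for all $0\le j<n$, then $$|Df^{n}(x_0)(v)|\ \ge\ C\lambda_0^n .$$
   Context: Here $0<|\lambda|<1$, $d\ge2$ is an integer, and $c$ is a non-constant holomorphic function near $0\in\mathbb{C}$ normalized so that $c(z)=c(0)+z^k+$ higher order terms, where $k\ge1$ is the order of $c$ at $0$. The number $0<r_0<1$ is fixed so that $c$ is holomorphic on $B(0,r_0)$ and $|c(z)-c(0)-z^k|\le|z^k|$ for all $z\in B(0,r_0)$, where $B(a,r)\subset\mathbb{C}$ is the open disk. The map $f$ is a self-map of $B(0,r_0)\times\mathbb{C}$. An orbit $\{x_i=(z_i,w_i)\}_{0\le i\le n}$ of $f$ (i.e. $x_{i+1}=f(x_i)$) is called tame if $|z_0|<r_0$ and $|z_i|^k\le|w_i|^d$ for every $0\le i<n$. The vector $v=(0,1)$ is the unit vertical vector, and $|\cdot|$ on vectors is the Euclidean norm. *)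

theory Defs
  imports
    "HOL-Complex_Analysis.Complex_Analysis"
    "HOL-Library.Landau_Symbols"
begin

definition skew_map ::
    "complex \<Rightarrow> nat \<Rightarrow> (complex \<Rightarrow> complex) \<Rightarrow> complex \<times> complex \<Rightarrow> complex \<times> complex" where
  "skew_map l d c = (\<lambda>(z, w). (l * z, w ^ d + c z))"

definition orbit_segment :: "('a \<Rightarrow> 'a) \<Rightarrow> nat \<Rightarrow> (nat \<Rightarrow> 'a) \<Rightarrow> bool" where
  "orbit_segment f n x \<longleftrightarrow> (\<forall>i<n. x (Suc i) = f (x i))"

text \<open>The point x n is not subject to the growth condition of tameness.  Values of x beyond n
  are irrelevant.\<close>

definition tame_orbit ::
    "real \<Rightarrow> nat \<Rightarrow> nat \<Rightarrow> (complex \<times> complex \<Rightarrow> complex \<times> complex) \<Rightarrow> nat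
      \<Rightarrow> (nat \<Rightarrow> complex \<times> complex) \<Rightarrow> bool" where
  "tame_orbit r0 k d f n x \<longleftrightarrow>
     orbit_segment f n x \<and>
     norm (fst (x 0)) < r0 \<and>
     (\<forall>i<n. norm (fst (x i)) ^ k \<le> norm (snd (x i)) ^ d)"

text \<open>A cycle is represented by any one of its points w together with its exact period p;
  its multiplier is the derivative of the p-th iterate at w.\<close>

definition cycle_point :: "('a \<Rightarrow> 'a) \<Rightarrow> nat \<Rightarrow> 'a \<Rightarrow> bool" where
  "cycle_point g p w \<longleftrightarrow>
     p > 0 \<and> (g ^^ p) w = w \<and> (\<forall>q. 0 < q \<and> q < p \<longrightarrow> (g ^^ q) w \<noteq> w)"

definition multiplier :: "(complex \<Rightarrow> complex) \<Rightarrow> nat \<Rightarrow> complex \<Rightarrow> complex" where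
  "multiplier g p w = deriv (g ^^ p) w"

definition has_attracting_cycle :: "(complex \<Rightarrow> complex) \<Rightarrow> bool" where
  "has_attracting_cycle g \<longleftrightarrow>
     (\<exists>p w. cycle_point g p w \<and> 0 < norm (multiplier g p w) \<and> norm (multiplier g p w) < 1)"

definition has_superattracting_cycle :: "(complex \<Rightarrow> complex) \<Rightarrow> bool" where
  "has_superattracting_cycle g \<longleftrightarrow> (\<exists>p w. cycle_point g p w \<and> multiplier g p w = 0)"

end

theory Submission
  imports Defs
begin

text \<open>
  Write \<open>f w = w ^ d + a\<close> with \<open>a = c 0\<close>.  The skew product is triangular, so the vertical derivative
  along an orbit \<open>(z\<^sub>i, w\<^sub>i)\<close> is the product of the numbers \<open>d * |w\<^sub>i| ^ (d - 1)\<close>, and the whole question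
  concerns the sequence \<open>w\<^sub>i\<close>, which is an orbit of \<open>f\<close> up to errors.  The errors are at most
  \<open>2 * |z\<^sub>i| ^ k\<close>: they decay geometrically, and by tameness they never exceed \<open>2 * |w\<^sub>i| ^ d\<close>, twice the
  distance of \<open>f w\<^sub>i\<close> from the critical value.

  The source of all bounds is one contradiction: if some iterate of \<open>f\<close> maps a disc well inside
  itself, then \<open>f\<close> has a cycle with multiplier smaller than 1 (Brouwer and the Cauchy estimate).
  Such discs arise from contraction.  Measure size at time \<open>i\<close> relative to \<open>|w\<^sub>i|\<close>, the distance to
  the critical point.  Call a time contracted if from then on the relative derivative decays like
  \<open>lam ^ j\<close>; discs around \<open>w\<^sub>i\<close> whose radius is a small multiple of \<open>|w\<^sub>i|\<close> then shrink with small
  distortion.  There are two ways to close up such a disc.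

  \<^item> If \<open>w\<^sub>q\<close> is very close to 0, the disc may be enlarged to contain 0, since all of it is mapped near
    the critical value.  If the orbit ends closer to 0 than \<open>w\<^sub>q\<close>, the disc about 0 is mapped into itself
    (\<open>no_contracting_close_return\<close>).
  \<^item> If \<open>w\<^sub>q\<close> stays away from 0, compactness makes two of many such times come close to each other, and
    the disc about the first is mapped into itself at the second.

  If the derivative over \<open>n\<close> steps were far below \<open>lam0 ^ n\<close>, a Pliss type argument
  (\<open>drop_le_card_right_maxima\<close>) would produce a positive density of contracted times: none of them can
  be close to 0, and too many of them away from 0 close up within a bounded window, where
  errors late in the orbit are harmless.  This gives \<open>derivative_lower_bound\<close>.

  Its constant is not 1, so it cannot be iterated as it stands.  However, an orbit that starts very close to 0 needs
  a long time to return, because 0 is not periodic, and over a long time the constant is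
  absorbed by a slightly smaller rate (\<open>return_bounds\<close>).  Chaining successive returns that come
  closer and closer to 0 yields \<open>closest_return_bound\<close>, the second assertion.  Chaining in the
  other direction, along the closest approaches that remain, yields
  \<open>after_closest_approach_bound\<close>; combined at the time when the orbit is closest to 0 they yield the first
  assertion.

  In the first way of closing up, the errors must be compared with the radius of a disc
  that may shrink faster than the errors decay.  The estimate that prevents this is a lower bound
  for the derivative of the iterates of \<open>f\<close> at the critical value, which is itself the error-free
  case of \<open>after_closest_approach_bound\<close>.  The argument is therefore run twice: without errors to obtain
  \<open>critical_growth\<close>, and then with errors.
\<close>


section \<open>Contracting discs of unicritical polynomials\<close>

definition unicrit :: "nat \<Rightarrow> complex \<Rightarrow> complex \<Rightarrow> complex" where
  "unicrit d a w = w ^ d + a"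

text \<open>The modulus of the derivative of the \<open>t\<close>-th iterate at the critical value.\<close>

definition crit_deriv :: "nat \<Rightarrow> complex \<Rightarrow> nat \<Rightarrow> real" where
  "crit_deriv d a t = (\<Prod>i<t. real d * norm ((unicrit d a ^^ i) a) ^ (d - 1))"

lemma norm_power_diff_le:
  fixes x y :: complex
  assumes "norm x \<le> M" "norm y \<le> M"
  shows "norm (x ^ d - y ^ d) \<le> real d * M ^ (d - 1) * norm (x - y)"
proof (induction d)
  case (Suc d)
  have M: "0 \<le> M" using assms norm_ge_zero order_trans by blast
  have "x ^ Suc d - y ^ Suc d = x * (x ^ d - y ^ d) + (x - y) * y ^ d"
    by (simp add: algebra_simps)
  hence "norm (x ^ Suc d - y ^ Suc d) \<le> norm x * norm (x ^ d - y ^ d) + norm (x - y) * norm y ^ d"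
    by (metis norm_mult norm_power norm_triangle_ineq)
  also have "\<dots> \<le> M * (real d * M ^ (d - 1) * norm (x - y)) + norm (x - y) * M ^ d"
    using assms M Suc by (intro add_mono mult_mono power_mono) auto
  also have "\<dots> = real (Suc d) * M ^ (Suc d - 1) * norm (x - y)"
    by (cases d) (auto simp: algebra_simps)
  finally show ?case .
qed simp

lemma unicrit_ball_image:
  assumes "norm (y - w) \<le> r"
  shows "norm (unicrit d a y - unicrit d a w) \<le> real d * (norm w + r) ^ (d - 1) * r"
proof -
  have r: "0 \<le> r" using assms norm_ge_zero order_trans by blast
  have "norm y \<le> norm w + r" using assms norm_triangle_sub[of y w] by linarith
  hence "norm (y ^ d - w ^ d) \<le> real d * (norm w + r) ^ (d - 1) * norm (y - w)"
    using r by (intro norm_power_diff_le) auto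
  also have "\<dots> \<le> real d * (norm w + r) ^ (d - 1) * r"
    using assms r by (intro mult_left_mono) auto
  finally show ?thesis by (simp add: unicrit_def)
qed

lemma holomorphic_unicrit_iter: "(unicrit d a ^^ p) holomorphic_on S"
proof (induction p arbitrary: S)
  case (Suc p)
  have "(\<lambda>w. ((unicrit d a ^^ p) w) ^ d + a) holomorphic_on S"
    by (intro holomorphic_intros Suc)
  moreover have "(unicrit d a ^^ Suc p) = (\<lambda>w. ((unicrit d a ^^ p) w) ^ d + a)"
    by (auto simp: unicrit_def)
  ultimately show ?case by metis
qed (simp add: id_def)

text \<open>Brouwer's theorem on the smaller disc gives the fixed point; around it there is still a disc of
  radius \<open>2 * r\<close> that is mapped into a disc of radius \<open>r\<close>, so the Cauchy estimate bounds the multiplier by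
  \<open>1/2\<close>.\<close>

lemma nested_ball_imp_contracting_cycle:
  assumes maps: "\<And>v. norm (v - x) \<le> \<rho> \<Longrightarrow> norm ((unicrit d a ^^ p) v - y) \<le> r"
    and "0 < r" and le: "norm (x - y) + 3 * r \<le> \<rho>"
  shows "\<exists>v. (unicrit d a ^^ p) v = v \<and> norm (deriv (unicrit d a ^^ p) v) < 1"
proof -
  define g where "g = unicrit d a ^^ p"
  have hol: "g holomorphic_on S" for S
    unfolding g_def by (rule holomorphic_unicrit_iter)
  have near: "norm (v - x) \<le> \<rho>" if "norm (v - y) \<le> 3 * r" for v
    using norm_triangle_ineq[of "v - y" "y - x"] that le norm_minus_commute[of x y] by simp
  have "g \<in> cball y r \<rightarrow> cball y r"
  proof
    fix v assume v: "v \<in> cball y r"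
    have "norm (v - y) \<le> 3 * r"
      using v \<open>0 < r\<close> by (simp add: dist_norm norm_minus_commute)
    then show "g v \<in> cball y r"
      using maps[OF near] by (simp add: dist_norm norm_minus_commute g_def)
  qed
  then obtain v where "v \<in> cball y r" and v2: "g v = v"
    using brouwer_ball[OF \<open>0 < r\<close>] hol holomorphic_on_imp_continuous_on by blast
  then have v: "norm (v - y) \<le> r" "g v = v"
    by (auto simp: dist_norm norm_minus_commute)
  have "norm ((deriv ^^ 1) (\<lambda>w. g w - y) v) \<le> fact 1 * r / (2 * r) ^ 1"
  proof (rule Cauchy_inequality)
    show "(\<lambda>w. g w - y) holomorphic_on ball v (2 * r)" by (intro holomorphic_intros hol)
    show "continuous_on (cball v (2 * r)) (\<lambda>w. g w - y)"
      by (intro continuous_intros holomorphic_on_imp_continuous_on hol)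
    show "0 < 2 * r" using \<open>0 < r\<close> by simp
    fix u assume "norm (v - u) = 2 * r"
    hence "norm (u - y) \<le> 3 * r"
      using norm_triangle_ineq[of "u - v" "v - y"] v by (simp add: norm_minus_commute)
    thus "norm (g u - y) \<le> r" unfolding g_def by (intro maps near)
  qed
  moreover have "deriv (\<lambda>w. g w - y) v = deriv g v"
    using hol[of UNIV] by (subst deriv_diff) (auto simp: holomorphic_on_def field_differentiable_at_within)
  ultimately have "norm (deriv g v) \<le> 1 / 2" using \<open>0 < r\<close> by simp
  with v show ?thesis unfolding g_def by (intro exI[of _ v]) auto
qed

text \<open>Reduces arbitrary periods to exact periods: a cycle of exact period \<open>m\<close> that is run through \<open>s\<close> times
  has the \<open>s\<close>-th power of its multiplier.\<close>

lemma deriv_unicrit_iter_fixed_power: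
  assumes "(unicrit d a ^^ m) w = w"
  shows "(unicrit d a ^^ (m * s)) w = w \<and>
    deriv (unicrit d a ^^ (m * s)) w = deriv (unicrit d a ^^ m) w ^ s"
proof (induction s)
  case (Suc s)
  define g where "g = unicrit d a ^^ m"
  define h where "h = unicrit d a ^^ (m * s)"
  have eq: "unicrit d a ^^ (m * Suc s) = g \<circ> h"
    by (simp add: g_def h_def funpow_add)
  have diff: "(unicrit d a ^^ j) field_differentiable at u" for j u
    using holomorphic_unicrit_iter[of j d a UNIV] by (auto simp: holomorphic_on_def)
  have "h w = w" using Suc h_def by simp
  then have "deriv (g \<circ> h) w = deriv g w * deriv h w"
    using deriv_chain[of h w g] diff g_def h_def by simp
  then show ?case using Suc assms \<open>h w = w\<close> by (simp only: eq) (simp add: g_def h_def)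
qed (simp add: id_def)

lemma no_attracting_cycle_imp_multiplier_ge_1:
  assumes na: "\<not> has_attracting_cycle (\<lambda>w. w ^ d + a)"
    and ns: "\<not> has_superattracting_cycle (\<lambda>w. w ^ d + a)"
    and p: "0 < p" "(unicrit d a ^^ p) w = w"
  shows "1 \<le> norm (deriv (unicrit d a ^^ p) w)"
proof -
  have f: "(\<lambda>w. w ^ d + a) = unicrit d a" by (auto simp: unicrit_def)
  define m where "m = (LEAST q. 0 < q \<and> (unicrit d a ^^ q) w = w)"
  have m: "0 < m" "(unicrit d a ^^ m) w = w"
    using LeastI[of "\<lambda>q. 0 < q \<and> (unicrit d a ^^ q) w = w" p] p unfolding m_def by auto
  have least: "m \<le> q" if "0 < q" "(unicrit d a ^^ q) w = w" for q
    unfolding m_def using that by (intro Least_le) auto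
  have "cycle_point (unicrit d a) m w"
    unfolding cycle_point_def using m least by (meson not_less)
  then have "1 \<le> norm (deriv (unicrit d a ^^ m) w)"
    using na ns unfolding has_attracting_cycle_def has_superattracting_cycle_def f multiplier_def
    by (metis norm_eq_zero not_le norm_ge_zero order_le_less)
  define s where "s = p div m"
  have "(unicrit d a ^^ (p mod m)) w = w"
  proof -
    have "(unicrit d a ^^ p) w = (unicrit d a ^^ (p mod m)) ((unicrit d a ^^ (m * s)) w)"
      by (metis s_def funpow_add comp_apply mod_mult_div_eq)
    thus ?thesis using p deriv_unicrit_iter_fixed_power[OF m(2)] by simp
  qed
  then have "p mod m = 0" using least[of "p mod m"] m(1) by (meson mod_less_divisor not_le neq0_conv)
  then have "p = m * s" by (auto simp: s_def)
  then show ?thesis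
    using deriv_unicrit_iter_fixed_power[OF m(2), of s] \<open>1 \<le> norm (deriv (unicrit d a ^^ m) w)\<close>
    by (simp add: norm_power)
qed

section \<open>Counting right maxima, and close pairs\<close>

text \<open>A version of the lemma of Pliss.  Walk from 0 to \<open>n\<close>: at a right maximum step to the next index, losing
  at most \<open>B\<close>; elsewhere jump to a later index with a larger value, losing nothing.\<close>

lemma drop_le_card_right_maxima:
  fixes X :: "nat \<Rightarrow> real"
  assumes drop: "\<And>q. \<lbrakk>q < n; \<forall>j. q < j \<and> j \<le> n \<longrightarrow> X j \<le> X q\<rbrakk> \<Longrightarrow> X q - X (Suc q) \<le> B"
    and B: "0 \<le> B"
  shows "X 0 - X n \<le> B * card {q. q < n \<and> (\<forall>j. q < j \<and> j \<le> n \<longrightarrow> X j \<le> X q)}"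
proof -
  define H where "H p = {q. p \<le> q \<and> q < n \<and> (\<forall>j. q < j \<and> j \<le> n \<longrightarrow> X j \<le> X q)}" for p
  have fin: "finite (H p)" for p unfolding H_def by simp
  have "X p - X n \<le> B * card (H p)" if "p \<le> n" for p
    using that
  proof (induction "n - p" arbitrary: p rule: less_induct)
    case less
    show ?case
    proof (cases "p = n")
      case False
      with less have "p < n" by simp
      show ?thesis
      proof (cases "\<forall>j. p < j \<and> j \<le> n \<longrightarrow> X j \<le> X p")
        case True
        have "H p = insert p (H (Suc p))"
          unfolding H_def using True \<open>p < n\<close> by (auto simp: Suc_le_eq le_less)
        moreover have "p \<notin> H (Suc p)" by (auto simp: H_def)
        ultimately have "card (H p) = Suc (card (H (Suc p)))" using fin by simp
        moreover have "X (Suc p) - X n \<le> B * card (H (Suc p))"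
          using less(1)[of "Suc p"] \<open>p < n\<close> by simp
        moreover have "X p - X (Suc p) \<le> B" using drop \<open>p < n\<close> True by blast
        ultimately show ?thesis by (simp add: algebra_simps)
      next
        case False
        then obtain j where j: "p < j" "j \<le> n" "X p < X j" by force
        have "X j - X n \<le> B * card (H j)" using less(1)[of j] j by simp
        also have "\<dots> \<le> B * card (H p)"
          using B j fin by (intro mult_left_mono) (auto intro!: card_mono simp: H_def)
        finally show ?thesis using j by simp
      qed
    qed (use B in simp)
  qed
  from this[of 0] show ?thesis by (simp add: H_def)
qed

lemma card_le_of_windows:
  assumes H: "H \<subseteq> {..<n}" and T: "0 < T"
    and win: "\<And>s. M \<le> s \<Longrightarrow> card (H \<inter> {s..<s + T}) \<le> L"
  shows "card H \<le> M + (n div T + 1) * L"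
proof -
  have fin: "finite H" using H finite_subset by blast
  have "H \<subseteq> {..<M} \<union> (\<Union>i<n div T + 1. H \<inter> {M + i * T..<M + i * T + T})"
  proof
    fix q assume q: "q \<in> H"
    show "q \<in> {..<M} \<union> (\<Union>i<n div T + 1. H \<inter> {M + i * T..<M + i * T + T})"
    proof (cases "q < M")
      case False
      define i where "i = (q - M) div T"
      have "q - M = i * T + (q - M) mod T" by (simp add: i_def)
      moreover have "(q - M) mod T < T" using T by simp
      ultimately have "q \<in> {M + i * T..<M + i * T + T}" using False by auto
      moreover have "i < n div T + 1"
        using q H unfolding i_def by (auto intro!: le_imp_less_Suc div_le_mono)
      ultimately show ?thesis using q by blast
    qed simp
  qed
  then have "card H \<le> card ({..<M} \<union> (\<Union>i<n div T + 1. H \<inter> {M + i * T..<M + i * T + T}))"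
    using fin by (intro card_mono) auto
  also have "\<dots> \<le> card {..<M} + card (\<Union>i<n div T + 1. H \<inter> {M + i * T..<M + i * T + T})"
    by (rule card_Un_le)
  also have "\<dots> \<le> M + (\<Sum>i<n div T + 1. card (H \<inter> {M + i * T..<M + i * T + T}))"
    using card_UN_le[of "{..<n div T + 1}" "\<lambda>i. H \<inter> {M + i * T..<M + i * T + T}"] by simp
  also have "\<dots> \<le> M + (\<Sum>i<n div T + 1. L)"
    by (intro add_left_mono sum_mono win) simp
  finally show ?thesis by simp
qed

text \<open>Pigeonhole on the pair (disc of a finite cover, residue modulo \<open>G\<close>): two distinct numbers
  with the same residue are at distance at least \<open>G\<close>.\<close>

lemma separated_close_pair:
  fixes R r :: real
  assumes "0 < r" and "0 < G"
  shows "\<exists>L. \<forall>H (w :: nat \<Rightarrow> complex). L < card H \<longrightarrow> (\<forall>q\<in>H. norm (w q) \<le> R) \<longrightarrow>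
    (\<exists>q\<in>H. \<exists>q'\<in>H. q + G \<le> q' \<and> norm (w q - w q') \<le> r)"
proof -
  have "compact (cball 0 R :: complex set)" by simp
  then obtain k where k: "finite k" "cball (0::complex) R \<subseteq> (\<Union>x\<in>k. ball x (r / 2))"
    using \<open>0 < r\<close> unfolding compact_eq_totally_bounded by (meson half_gt_zero)
  show ?thesis
  proof (intro exI[of _ "card (k \<times> {..<G})"] allI impI)
    fix H :: "nat set" and w :: "nat \<Rightarrow> complex"
    assume card: "card (k \<times> {..<G}) < card H" and R: "\<forall>q\<in>H. norm (w q) \<le> R"
    have "\<forall>q\<in>H. \<exists>x\<in>k. w q \<in> ball x (r / 2)" using R k(2) by (fastforce simp: dist_norm)
    then obtain \<phi> where \<phi>: "\<forall>q\<in>H. \<phi> q \<in> k \<and> w q \<in> ball (\<phi> q) (r / 2)" by metis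
    define g where "g q = (\<phi> q, q mod G)" for q
    have "g ` H \<subseteq> k \<times> {..<G}" using \<phi> \<open>0 < G\<close> by (auto simp: g_def)
    then have "card (g ` H) \<le> card (k \<times> {..<G})" using k(1) by (intro card_mono) auto
    then have "\<not> inj_on g H" using card card_image by fastforce
    then obtain p p' where "p \<in> H" "p' \<in> H" "g p = g p'" "p \<noteq> p'" by (auto simp: inj_on_def)
    then obtain q q' where q: "q \<in> H" "q' \<in> H" "g q = g q'" "q < q'"
      by (metis linorder_neqE_nat)
    have "G dvd q' - q" using q mod_eq_dvd_iff_nat[of q q' G] by (simp add: g_def)
    then have "q + G \<le> q'" using q dvd_imp_le[of G "q' - q"] by simp
    moreover have "norm (w q - w q') \<le> r"
    proof -
      have "dist (\<phi> q) (w q) < r / 2" "dist (\<phi> q) (w q') < r / 2"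
        using \<phi> q by (auto simp: g_def)
      then have "dist (w q) (w q') < r" by (rule dist_triangle_half_r)
      then show ?thesis by (simp add: dist_norm)
    qed
    ultimately show "\<exists>q\<in>H. \<exists>q'\<in>H. q + G \<le> q' \<and> norm (w q - w q') \<le> r" using q by blast
  qed
qed

lemma exists_small_distortion:
  assumes "1 < (kp::real)"
  shows "\<exists>\<delta>>0. \<delta> \<le> 1/3 \<and> (1 + 2 * \<delta>) ^ m \<le> kp"
proof -
  define s where "s = root (Suc m) kp"
  have s: "1 < s" "s ^ Suc m = kp" using assms by (auto simp: s_def simp del: power_Suc)
  define \<delta> where "\<delta> = min (1/3) ((s - 1) / 2)"
  have \<delta>: "0 < \<delta>" "\<delta> \<le> 1/3"
    using s(1) by (auto simp: \<delta>_def)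
  have "\<delta> \<le> (s - 1) / 2" unfolding \<delta>_def by (rule min.cobounded2)
  then have "1 + 2 * \<delta> \<le> s" by (simp add: field_simps)
  have "(1 + 2 * \<delta>) ^ m \<le> s ^ m" using \<delta> \<open>1 + 2 * \<delta> \<le> s\<close> by (intro power_mono) auto
  also have "\<dots> \<le> s ^ Suc m" using s by (intro power_increasing) auto
  finally show ?thesis using s \<delta> by auto
qed

section \<open>Perturbed orbits\<close>

text \<open>The number \<open>mu\<close> is the rate at which errors decay.  The pair \<open>kappa\<close>, \<open>theta\<close> enters only orbits with errors: it
  quantifies how fast errors decay in comparison with the derivative along the critical
  orbit.\<close>

locale perturbed_unicritical =
  fixes d :: nat and a :: complex and mu kappa theta :: real
  assumes d2: "2 \<le> d"
    and mult_ge_1: "\<And>p w. \<lbrakk>0 < p; (unicrit d a ^^ p) w = w\<rbrakk> \<Longrightarrow> 1 \<le> norm (deriv (unicrit d a ^^ p) w)"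
    and mu: "0 < mu" "mu < 1" and kappa: "0 \<le> kappa" and theta: "0 < theta" "theta < 1"
begin

abbreviation f where "f \<equiv> unicrit d a"
abbreviation df where "df \<equiv> \<lambda>w :: complex. real d * norm w ^ (d - 1)"

lemma f0: "f 0 = a" using d2 by (simp add: unicrit_def)

lemma critical_not_periodic: "(f ^^ t) a \<noteq> 0"
proof
  assume z: "(f ^^ t) a = 0"
  have per: "(f ^^ Suc t) 0 = 0" using z by (simp add: funpow_Suc_right f0 del: funpow.simps)
  have diff: "(f ^^ j) field_differentiable at u" for j u
    using holomorphic_unicrit_iter[of j d a UNIV] by (auto simp: holomorphic_on_def)
  have "((\<lambda>w. w ^ d + a) has_field_derivative of_nat d * 0 ^ (d - 1)) (at 0)"
    by (auto intro!: derivative_eq_intros)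
  moreover have "f = (\<lambda>w. w ^ d + a)" by (auto simp: unicrit_def)
  ultimately have "deriv f 0 = 0" using d2 DERIV_imp_deriv by fastforce
  moreover have "deriv (f ^^ t \<circ> f) 0 = deriv (f ^^ t) (f 0) * deriv f 0"
    by (rule deriv_chain) (use diff[of 1 0] diff in auto)
  ultimately have "deriv (f ^^ Suc t) 0 = 0" by (simp add: funpow_Suc_right del: funpow.simps)
  then show False using mult_ge_1[of "Suc t" 0] per by simp
qed

text \<open>The vertical coordinates of a tame orbit, with \<open>z = |z\<^sub>0| ^ k\<close> and hence \<open>|z\<^sub>i| ^ k = mu ^ i * z\<close>.  The third
  condition offers a choice: either there are no errors at all, or the growth of the critical
  orbit is already known.  It lets the same lemmas serve first for the exact orbits of \<open>f\<close> and
  then for the perturbed ones.\<close>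

definition tame_seq :: "nat \<Rightarrow> (nat \<Rightarrow> complex) \<Rightarrow> real \<Rightarrow> bool" where
  "tame_seq n w z \<longleftrightarrow> 0 \<le> z \<and> z \<le> 1 \<and>
     (z = 0 \<or> (\<forall>t. 2 * mu ^ t \<le> kappa * theta ^ t * crit_deriv d a t)) \<and>
     (\<forall>i<n. norm (w (Suc i) - f (w i)) \<le> 2 * mu ^ i * z \<and> mu ^ i * z \<le> norm (w i) ^ d)"

text \<open>The weaker condition on the first step allows \<open>w 0\<close> to be replaced by any point that is farther from 0
  without changing the rest of the orbit.  This is used to treat an orbit that starts closer to 0
  than it returns as if it had started at the distance of its return.\<close>

definition kicked_seq :: "nat \<Rightarrow> (nat \<Rightarrow> complex) \<Rightarrow> real \<Rightarrow> bool" where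
  "kicked_seq n w z \<longleftrightarrow> 0 \<le> z \<and> z \<le> 1 \<and>
     (z = 0 \<or> (\<forall>t. 2 * mu ^ t \<le> kappa * theta ^ t * crit_deriv d a t)) \<and>
     (\<forall>i<n. norm (w (Suc i) - f (w i)) \<le> (if i = 0 then 4 * norm (w 0) ^ d else 2 * mu ^ i * z) \<and>
        mu ^ i * z \<le> norm (w i) ^ d)"

lemma tame_imp_kicked: "tame_seq n w z \<Longrightarrow> kicked_seq n w z"
  unfolding tame_seq_def kicked_seq_def by fastforce

lemma tame_shift: 
  assumes "tame_seq n w z" "q \<le> n"
  shows "tame_seq (n - q) (\<lambda>i. w (q + i)) (mu ^ q * z)"
proof -
  have "mu ^ q * z \<le> 1" using assms mu unfolding tame_seq_def by (intro mult_le_one) (auto intro: power_le_one)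
  moreover have "norm (w (Suc (q + i)) - f (w (q + i))) \<le> 2 * mu ^ i * (mu ^ q * z) \<and>
      mu ^ i * (mu ^ q * z) \<le> norm (w (q + i)) ^ d" if "i < n - q" for i
  proof -
    have "q + i < n" using that by auto
    then have "norm (w (Suc (q + i)) - f (w (q + i))) \<le> 2 * mu ^ (q + i) * z \<and>
        mu ^ (q + i) * z \<le> norm (w (q + i)) ^ d"
      using assms(1) unfolding tame_seq_def by blast
    then show ?thesis by (simp add: power_add mult_ac)
  qed
  ultimately show ?thesis using assms mu unfolding tame_seq_def by simp
qed

lemma kicked_truncate: "kicked_seq n w z \<Longrightarrow> m \<le> n \<Longrightarrow> kicked_seq m w z"
  unfolding kicked_seq_def by auto

lemma tame_truncate: "tame_seq n w z \<Longrightarrow> m \<le> n \<Longrightarrow> tame_seq m w z"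
  unfolding tame_seq_def by auto

lemma kicked_tail:
  assumes "kicked_seq n w z" "0 < q" "q \<le> n"
  shows "tame_seq (n - q) (\<lambda>i. w (q + i)) (mu ^ q * z)"
proof -
  have "mu ^ q * z \<le> 1" using assms mu unfolding kicked_seq_def by (intro mult_le_one) (auto intro: power_le_one)
  moreover have "norm (w (Suc (q + i)) - f (w (q + i))) \<le> 2 * mu ^ i * (mu ^ q * z) \<and>
      mu ^ i * (mu ^ q * z) \<le> norm (w (q + i)) ^ d" if "i < n - q" for i
  proof -
    have "q + i < n" "q + i \<noteq> 0" using that \<open>0 < q\<close> by auto
    then have "norm (w (Suc (q + i)) - f (w (q + i))) \<le> 2 * mu ^ (q + i) * z \<and>
        mu ^ (q + i) * z \<le> norm (w (q + i)) ^ d"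
      using assms(1) unfolding kicked_seq_def by (auto dest!: spec[of _ "q + i"])
    then show ?thesis by (simp add: power_add mult_ac)
  qed
  ultimately show ?thesis using assms mu unfolding tame_seq_def kicked_seq_def by simp
qed

lemma kicked_shift:
  assumes "kicked_seq n w z" "q \<le> n"
  shows "kicked_seq (n - q) (\<lambda>i. w (q + i)) (mu ^ q * z)"
  using assms kicked_tail[OF assms(1), of q] tame_imp_kicked by (cases "q = 0") auto

text \<open>The point \<open>w 1\<close> is at distance of order \<open>|w 0| ^ d\<close> from the critical value, and so are all later errors; for
  a bounded time these are amplified at most by a fixed Lipschitz constant \<open>K\<close>.\<close>

lemma kicked_shadows_critical_orbit:
  assumes ps: "kicked_seq n w z" and R: "1 \<le> R" "\<And>j. j < n \<Longrightarrow> norm (w j) \<le> R"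
    and K: "K = real d * (R + 1) ^ (d - 1)" and w0: "5 * norm (w 0) * (K + 1) ^ N \<le> 1"
    and t: "t \<le> N" "Suc t \<le> n"
  shows "norm (w (Suc t) - (f ^^ t) a) \<le> 5 * norm (w 0) * (K + 1) ^ t"
proof -
  have K0: "0 \<le> K" using K R by simp
  have "5 * norm (w 0) * 1 \<le> 5 * norm (w 0) * (K + 1) ^ N"
    using K0 by (intro mult_left_mono one_le_power) auto
  then have "norm (w 0) \<le> 1" using w0 by linarith
  then have pd: "norm (w 0) ^ d \<le> norm (w 0)" using d2 power_decreasing[of 1 d "norm (w 0)"] \<open>norm (w 0) \<le> 1\<close> by (simp del: power_decreasing_iff)
  show ?thesis using t
  proof (induction t)
    case 0
    have "norm (w 1 - f (w 0)) \<le> 4 * norm (w 0) ^ d" using ps 0 unfolding kicked_seq_def by auto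
    moreover have "norm (f (w 0) - a) = norm (w 0) ^ d" by (simp add: unicrit_def norm_power)
    ultimately have "norm (w 1 - a) \<le> 5 * norm (w 0) ^ d"
      using norm_triangle_ineq[of "w 1 - f (w 0)" "f (w 0) - a"] by simp
    then show ?case using pd by simp
  next
    case (Suc t)
    define y where "y = (f ^^ t) a"
    have IH: "norm (w (Suc t) - y) \<le> 5 * norm (w 0) * (K + 1) ^ t" using Suc y_def by simp
    have "5 * norm (w 0) * (K + 1) ^ t \<le> 5 * norm (w 0) * (K + 1) ^ N"
      using K0 Suc.prems by (intro mult_left_mono power_increasing) auto
    then have "norm (w (Suc t) - y) \<le> 1" using IH w0 by linarith
    moreover have wR: "norm (w (Suc t)) \<le> R" using R Suc.prems by simp
    ultimately have yR: "norm y \<le> R + 1"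
      using norm_triangle_sub[of y "w (Suc t)"] by (simp add: norm_minus_commute)
    have "norm (w (Suc t) ^ d - y ^ d) \<le> K * norm (w (Suc t) - y)"
      unfolding K using wR yR by (intro norm_power_diff_le) auto
    also have "\<dots> \<le> K * (5 * norm (w 0) * (K + 1) ^ t)" using IH K0 by (intro mult_left_mono) auto
    finally have A: "norm (f (w (Suc t)) - f y) \<le> K * (5 * norm (w 0) * (K + 1) ^ t)"
      by (simp add: unicrit_def)
    have "norm (w (Suc (Suc t)) - f (w (Suc t))) \<le> 2 * mu ^ Suc t * z"
      using ps Suc.prems unfolding kicked_seq_def by (auto dest!: spec[of _ "Suc t"])
    also have "\<dots> \<le> 2 * z" using ps mu unfolding kicked_seq_def
      using mult_right_mono[of "2 * mu ^ Suc t" 2 z] power_le_one[of mu "Suc t"] by simp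
    also have "z \<le> norm (w 0) ^ d"
      using ps Suc.prems unfolding kicked_seq_def by (auto dest!: spec[of _ "0::nat"])
    also have "\<dots> \<le> norm (w 0)" by (rule pd)
    finally have B: "norm (w (Suc (Suc t)) - f (w (Suc t))) \<le> 2 * norm (w 0)" by simp
    have "norm (w (Suc (Suc t)) - f y) \<le> 2 * norm (w 0) + K * (5 * norm (w 0) * (K + 1) ^ t)"
      using norm_triangle_ineq[of "w (Suc (Suc t)) - f (w (Suc t))" "f (w (Suc t)) - f y"] A B by simp
    also have "2 * norm (w 0) \<le> 5 * norm (w 0) * (K + 1) ^ t"
      using K0 one_le_power[of "K + 1" t] mult_mono[of 2 5 "norm (w 0)" "norm (w 0) * (K+1)^t"]
      by (simp add: mult_le_cancel_left1)
    finally show ?case by (simp add: y_def algebra_simps)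
  qed
qed

text \<open>Since 0 is not periodic, the first \<open>N\<close> points of the critical orbit stay away from 0, and so do
  the points of an orbit that shadows it.\<close>

lemma late_return:
  assumes R: "1 \<le> R"
  shows "\<exists>b>0. \<exists>\<epsilon>>0. \<epsilon> < b \<and> (\<forall>n w z. kicked_seq n w z \<longrightarrow> (\<forall>j<n. norm (w j) \<le> R) \<longrightarrow> norm (w 0) < \<epsilon> \<longrightarrow>
     (\<forall>j. 0 < j \<and> j \<le> n \<and> j \<le> N \<longrightarrow> b \<le> norm (w j)))"
proof -
  define K where "K = real d * (R + 1) ^ (d - 1)"
  have K0: "0 \<le> K" using R by (simp add: K_def)
  define S where "S = insert 1 ((\<lambda>t. norm ((f ^^ t) a)) ` {..N})"
  have S: "finite S" "S \<noteq> {}" by (auto simp: S_def)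
  define b where "b = Min S / 2"
  have "0 < Min S" using S critical_not_periodic by (auto simp: S_def)
  then have b: "0 < b" by (simp add: b_def)
  have b1: "2 * b \<le> 1" using S by (simp add: b_def S_def)
  have bt: "2 * b \<le> norm ((f ^^ t) a)" if "t \<le> N" for t
  proof -
    have "Min S \<le> norm ((f ^^ t) a)" by (rule Min_le[OF S(1)]) (use that in \<open>auto simp: S_def\<close>)
    then show ?thesis by (simp add: b_def)
  qed
  define \<epsilon> where "\<epsilon> = b / (6 * (K + 1) ^ N)"
  have \<epsilon>0: "0 < \<epsilon>" using b K0 by (simp add: \<epsilon>_def)
  have "b * 1 < b * (6 * (K + 1) ^ N)"
  proof (rule mult_strict_left_mono[OF _ b])
    show "1 < 6 * (K + 1) ^ N" using one_le_power[of "K + 1" N] K0 by linarith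
  qed
  then have \<epsilon>b: "\<epsilon> < b" using K0 by (simp add: \<epsilon>_def divide_simps)
  show ?thesis
  proof (rule exI[of _ b], intro conjI b, rule exI[of _ \<epsilon>], intro conjI allI impI \<epsilon>0 \<epsilon>b)
    fix n w z j
    assume ps: "kicked_seq n w z" and wR: "\<forall>j<n. norm (w j) \<le> R" and w0: "norm (w 0) < \<epsilon>"
      and j: "0 < j \<and> j \<le> n \<and> j \<le> N"
    have "norm (w 0) * (6 * (K + 1) ^ N) \<le> b"
      using w0 K0 by (simp add: \<epsilon>_def pos_less_divide_eq)
    moreover have "0 \<le> norm (w 0) * (K + 1) ^ N" using K0 by simp
    ultimately have w0': "5 * norm (w 0) * (K + 1) ^ N \<le> b"
      by (simp add: algebra_simps)
    then have 1: "5 * norm (w 0) * (K + 1) ^ N \<le> 1" using b1 b by linarith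
    obtain t where t: "j = Suc t" using j by (cases j) auto
    have "norm (w (Suc t) - (f ^^ t) a) \<le> 5 * norm (w 0) * (K + 1) ^ t"
      using kicked_shadows_critical_orbit[OF ps R _ K_def 1, of t] wR j t by auto
    also have "\<dots> \<le> 5 * norm (w 0) * (K + 1) ^ N"
      using K0 j t by (intro mult_left_mono power_increasing) auto
    finally have "norm (w j - (f ^^ t) a) \<le> b" using w0' t by simp
    moreover have "2 * b \<le> norm ((f ^^ t) a)" using bt j t by simp
    ultimately show "b \<le> norm (w j)"
      using norm_triangle_sub[of "(f ^^ t) a" "w j"] by (simp add: norm_minus_commute)
  qed
qed

section \<open>Contracted times\<close>

text \<open>The unit of length at time \<open>j\<close>: the distance to the critical point, except at the final time, where
  the point may be much closer to 0 and a unit \<open>s\<close> is prescribed instead.\<close>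

definition scale :: "nat \<Rightarrow> (nat \<Rightarrow> complex) \<Rightarrow> real \<Rightarrow> nat \<Rightarrow> real" where
  "scale n w s j = (if j < n then norm (w j) else s)"

definition contracted :: "real \<Rightarrow> nat \<Rightarrow> (nat \<Rightarrow> complex) \<Rightarrow> real \<Rightarrow> nat \<Rightarrow> bool" where
  "contracted lam n w s q \<longleftrightarrow>
     (\<forall>j. q < j \<and> j \<le> n \<longrightarrow> (\<Prod>i=q..<j. df (w i)) * scale n w s q \<le> lam ^ (j - q) * scale n w s j)"

lemma distortion_bound:
  assumes "r \<le> 2 * \<delta> * norm w" "0 \<le> r" "(1 + 2 * \<delta>) ^ (d - 1) \<le> kp"
  shows "real d * (norm w + r) ^ (d - 1) \<le> df w * kp"
proof -
  have "(norm w + r) ^ (d - 1) \<le> ((1 + 2 * \<delta>) * norm w) ^ (d - 1)"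
    using assms by (intro power_mono) (auto simp: algebra_simps)
  also have "\<dots> = (1 + 2 * \<delta>) ^ (d - 1) * norm w ^ (d - 1)" by (rule power_mult_distrib)
  also have "\<dots> \<le> kp * norm w ^ (d - 1)" using assms by (intro mult_right_mono) auto
  finally have "real d * (norm w + r) ^ (d - 1) \<le> real d * (kp * norm w ^ (d - 1))"
    by (rule mult_left_mono) simp
  then show ?thesis by (simp only: mult_ac)
qed

text \<open>Suppose that time 0 is contracted, and let \<open>\<rho> = |w 0|\<close>.  The disc of radius \<open>2 * \<rho>\<close> about 0 contains
  the critical point, but \<open>f\<close> maps it to a disc about the critical value of radius comparable to
  \<open>\<rho> ^ d\<close>, so the first step contracts strongly when \<open>\<rho>\<close> is small.  From then on the radii follow the
  derivative up to small distortion, and contraction keeps them below a small multiple of the distance to 0.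
  Errors at time \<open>j\<close> are at most a summable multiple of \<open>\<rho> ^ d\<close> times the derivative along the critical
  orbit, which the shrinking discs shadow as well; hence they only enlarge the discs by a
  bounded factor.  At the final time the disc is inside the one it started from.\<close>

lemma no_contracting_close_return:
  assumes R: "1 \<le> R" and lam1: "0 < lam1" "lam1 < 1"
  shows "\<exists>eps>0. \<forall>n w z s. kicked_seq n w z \<longrightarrow> 0 < n \<longrightarrow> (\<forall>j<n. 0 < norm (w j) \<and> norm (w j) \<le> R) \<longrightarrow>
    norm (w 0) < eps \<longrightarrow> norm (w n) \<le> norm (w 0) \<longrightarrow> 0 < s \<longrightarrow> s \<le> norm (w 0) \<longrightarrow>
    \<not> contracted lam1 n w s 0"
proof -
  define lam2 where "lam2 = sqrt lam1"
  define kp where "kp = 1 / lam2"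
  have lam2: "0 < lam2" "lam2 < 1" "lam1 * kp = lam2"
    using lam1 real_sqrt_mult_self[of lam1] by (auto simp: lam2_def kp_def field_simps)
  have kp: "1 < kp" using lam2 by (simp add: kp_def)
  obtain \<delta> where \<delta>: "0 < \<delta>" "\<delta> \<le> 1/3" "(1 + 2 * \<delta>) ^ (d - 1) \<le> kp"
    using exists_small_distortion[OF kp] by blast
  define K2 where "K2 = 2 ^ d + 5 + kappa / (1 - theta)"
  have K2: "1 \<le> K2" using kappa theta by (simp add: K2_def add_increasing2)
  obtain N where N: "lam2 ^ N < \<delta> / K2"
    using real_arch_pow_inv[of "\<delta> / K2" lam2] \<delta> K2 lam2 by auto
  from late_return[OF R, of N] obtain b \<epsilon> where b: "0 < b" and \<epsilon>: "0 < \<epsilon>" "\<epsilon> < b"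
    and far: "\<forall>n w z. kicked_seq n w z \<longrightarrow> (\<forall>j<n. norm (w j) \<le> R) \<longrightarrow> norm (w 0) < \<epsilon> \<longrightarrow>
     (\<forall>j. 0 < j \<and> j \<le> n \<and> j \<le> N \<longrightarrow> b \<le> norm (w j))"
    by (elim exE conjE)
  have ret: "b \<le> norm (w j)"
    if "kicked_seq n w z" "\<forall>j<n. norm (w j) \<le> R" "norm (w 0) < \<epsilon>" "0 < j" "j \<le> n" "j \<le> N" for n w z j
    by (rule far[rule_format, OF that(1) _ that(3)]) (use that in auto)
  define E where "E = real d * R ^ (d - 1) * kp"
  have "1 * 1 * 1 \<le> real d * R ^ (d - 1) * kp"
    using d2 R kp by (intro mult_mono one_le_power) auto
  then have E: "1 \<le> E" by (simp add: E_def)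
  define eps where "eps = min 1 (min \<epsilon> (\<delta> * b / (K2 * E ^ N)))"
  have eps: "0 < eps" "eps \<le> 1" "eps \<le> \<epsilon>" "eps \<le> \<delta> * b / (K2 * E ^ N)"
    using \<epsilon> \<delta> b K2 E by (auto simp: eps_def)
  have "\<not> contracted lam1 n w s 0"
    if ks: "kicked_seq n w z" and "0 < n" and w: "\<forall>j<n. 0 < norm (w j) \<and> norm (w j) \<le> R"
      and w0: "norm (w 0) < eps" and wn: "norm (w n) \<le> norm (w 0)" and s: "0 < s" "s \<le> norm (w 0)"
    for n w z s
  proof
    assume con: "contracted lam1 n w s 0"
    define \<rho> where "\<rho> = norm (w 0)"
    have \<rho>: "0 < \<rho>" "\<rho> < eps" using w \<open>0 < n\<close> w0 by (auto simp: \<rho>_def)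
    have \<rho>d: "\<rho> ^ d \<le> \<rho>" using \<rho> eps d2 power_decreasing[of 1 d \<rho>] by simp
    have "N < n"
    proof (rule ccontr)
      assume "\<not> N < n"
      then have "b \<le> norm (w n)" using ret[OF ks, of n] w w0 eps \<open>0 < n\<close> by simp
      then show False using wn w0 eps \<epsilon> by linarith
    qed
    \<comment> \<open>The radius at time \<open>j\<close> will be \<open>sg j * \<rho> ^ d * p j\<close>: \<open>p\<close> is the derivative with an allowance
  \<open>kp\<close> for distortion in each step, and \<open>sg\<close> collects the errors.\<close>
    define p where "p j = (\<Prod>i=1..<j. df (w i) * kp)" for j
    have p0: "0 \<le> p j" for j unfolding p_def using kp by (intro prod_nonneg) auto
    have pSuc: "p (Suc j) = p j * (df (w j) * kp)" if "1 \<le> j" for j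
      unfolding p_def using that by (simp add: prod.atLeastLessThan_Suc)
    define sg where "sg j = 2 ^ d + 5 + kappa * (\<Sum>i<j. theta ^ i)" for j :: nat
    have sg: "0 \<le> sg j" "sg j \<le> K2" for j
    proof -
      have "0 \<le> (\<Sum>i<j. theta ^ i)" using theta by (intro sum_nonneg) auto
      then show "0 \<le> sg j" using kappa by (simp add: sg_def)
      have "(\<Sum>i<j. theta ^ i) = (1 - theta ^ j) / (1 - theta)"
        using theta by (simp add: sum_gp_strict)
      also have "\<dots> \<le> 1 / (1 - theta)" using theta by (intro divide_right_mono) auto
      finally have "kappa * (\<Sum>i<j. theta ^ i) \<le> kappa * (1 / (1 - theta))" using kappa by (intro mult_left_mono) auto
      then show "sg j \<le> K2" by (simp add: sg_def K2_def)
    qed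
    define r where "r j = sg j * \<rho> ^ d * p j" for j
    have r0: "0 \<le> r j" for j unfolding r_def using sg p0 \<rho> by simp
    have rK: "r j \<le> K2 * (\<rho> ^ d * p j)" for j
      unfolding r_def using sg(2)[of j] p0[of j] \<rho> by (simp add: mult_right_mono mult.assoc)
    \<comment> \<open>The factor \<open>d * \<rho> ^ (d - 1)\<close> of time 0 is part of the contracted product but not of \<open>p\<close>; it
  supplies the power of \<open>\<rho>\<close>.\<close>
    have F1: "\<rho> ^ d * p j \<le> lam2 ^ j * scale n w s j" if j: "1 \<le> j" "j \<le> n" for j
    proof -
      define Q where "Q = (\<Prod>i=1..<j. df (w i))"
      have Q0: "0 \<le> Q" unfolding Q_def by (intro prod_nonneg) auto
      have pj: "p j = Q * kp ^ (j - 1)" by (simp add: p_def Q_def prod.distrib)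
      have "(\<Prod>i=0..<j. df (w i)) = df (w 0) * Q"
        unfolding Q_def using j by (subst prod.atLeast_Suc_lessThan) auto
      moreover have "(\<Prod>i=0..<j. df (w i)) * \<rho> \<le> lam1 ^ j * scale n w s j"
        using con j \<open>0 < n\<close> unfolding contracted_def \<rho>_def scale_def by auto
      moreover have "\<rho> ^ d = \<rho> ^ (d - 1) * \<rho>" using d2 by (metis One_nat_def Suc_1 Suc_le_D diff_Suc_1 power_Suc2)
      ultimately have A: "real d * \<rho> ^ d * Q \<le> lam1 ^ j * scale n w s j"
        by (simp add: \<rho>_def mult_ac)
      have "\<rho> ^ d * p j = 1 * (\<rho> ^ d * Q) * kp ^ (j - 1)" by (simp add: pj mult_ac)
      also have "\<dots> \<le> real d * (\<rho> ^ d * Q) * kp ^ j"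
      proof (rule mult_mono)
        show "kp ^ (j - 1) \<le> kp ^ j" using kp by (intro power_increasing) auto
        show "1 * (\<rho> ^ d * Q) \<le> real d * (\<rho> ^ d * Q)"
          using d2 \<rho> Q0 by (intro mult_right_mono) auto
      qed (use d2 \<rho> Q0 kp in auto)
      also have "\<dots> \<le> (lam1 ^ j * scale n w s j) * kp ^ j"
        using A kp by (intro mult_right_mono) (auto simp: mult_ac)
      also have "\<dots> = (lam1 * kp) ^ j * scale n w s j" by (simp add: power_mult_distrib)
      finally show ?thesis using lam2 by simp
    qed
    \<comment> \<open>Late radii are small by contraction, early ones (see \<open>F2\<close>) because \<open>\<rho>\<close> is small while the critical
  orbit is still at distance \<open>b\<close> from 0.\<close>
    have late: "r j \<le> \<delta> * scale n w s j" if j: "1 \<le> j" "j \<le> n" "N \<le> j" for j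
    proof -
      have u: "0 \<le> scale n w s j" using s by (simp add: scale_def)
      have "r j \<le> K2 * (\<rho> ^ d * p j)" by (rule rK)
      also have "\<dots> \<le> K2 * (lam2 ^ j * scale n w s j)" using F1 j K2 by (intro mult_left_mono) auto
      also have "\<dots> \<le> K2 * (lam2 ^ N * scale n w s j)"
        using K2 lam2 j u by (intro mult_left_mono mult_right_mono power_decreasing) auto
      also have "\<dots> = (K2 * lam2 ^ N) * scale n w s j" by simp
      also have "\<dots> \<le> \<delta> * scale n w s j"
        using N K2 u by (intro mult_right_mono) (auto simp: pos_less_divide_eq mult_ac)
      finally show ?thesis .
    qed
    have F2: "r j \<le> \<delta> * norm (w j)" if j: "1 \<le> j" "j < n" for j
    proof (cases "N \<le> j")
      case True
      then show ?thesis using late[of j] j by (simp add: scale_def)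
    next
      case False
      have "p j \<le> (\<Prod>i=1..<j. E)"
        unfolding p_def
      proof (intro prod_mono conjI)
        fix i assume "i \<in> {1..<j}"
        then have "norm (w i) \<le> R" using w j by auto
        then show "df (w i) * kp \<le> E" unfolding E_def using kp
          by (intro mult_right_mono mult_left_mono power_mono) auto
      qed (use kp in auto)
      also have "\<dots> \<le> E ^ N" using E False by (auto intro: power_increasing)
      finally have "p j \<le> E ^ N" .
      have "r j \<le> K2 * (\<rho> ^ d * p j)" by (rule rK)
      also have "\<dots> \<le> K2 * (eps * E ^ N)"
        using K2 \<rho> \<rho>d p0 \<open>p j \<le> E ^ N\<close> by (intro mult_left_mono mult_mono) auto
      also have "\<dots> \<le> \<delta> * b"
        using eps(4) K2 E by (simp add: le_divide_eq mult_ac)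
      also have "\<dots> \<le> \<delta> * norm (w j)"
        using ret[OF ks, of j] w w0 eps j False \<delta> by (intro mult_left_mono) auto
      finally show ?thesis .
    qed
    have F4: "real d * (norm (w j) + r j) ^ (d - 1) \<le> df (w j) * kp" if j: "1 \<le> j" "j < n" for j
    proof (rule distortion_bound[OF _ r0 \<delta>(3)])
      have "0 \<le> \<delta> * norm (w j)" using \<delta> by simp
      then show "r j \<le> 2 * \<delta> * norm (w j)" using F2[OF j] by linarith
    qed
    have main: "(\<forall>v. norm v \<le> 2 * \<rho> \<longrightarrow> norm ((f ^^ j) v - w j) \<le> r j) \<and> crit_deriv d a (j - 1) \<le> p j"
      if "1 \<le> j" "j \<le> n" for j
      using that
    proof (induction j rule: dec_induct)
      case base
      have "norm (f v - w 1) \<le> r 1" if v: "norm v \<le> 2 * \<rho>" for v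
      proof -
        have "norm (f v - a) \<le> 2 ^ d * \<rho> ^ d"
          using v power_mono[OF v, of d] by (simp add: unicrit_def norm_power power_mult_distrib)
        moreover have "norm (w 1 - f (w 0)) \<le> 4 * \<rho> ^ d"
          using ks \<open>0 < n\<close> unfolding kicked_seq_def \<rho>_def by auto
        moreover have "norm (f (w 0) - a) = \<rho> ^ d" by (simp add: unicrit_def norm_power \<rho>_def)
        moreover have "f v - w 1 = (f v - a) - (w 1 - f (w 0)) - (f (w 0) - a)" by simp
        ultimately have "norm (f v - w 1) \<le> 2 ^ d * \<rho> ^ d + 4 * \<rho> ^ d + \<rho> ^ d"
          by (smt (verit) norm_triangle_ineq4)
        also have "\<dots> = (2 ^ d + 5) * \<rho> ^ d" by (simp add: algebra_simps)
        also have "\<dots> \<le> sg 1 * \<rho> ^ d" using kappa \<rho> by (intro mult_right_mono) (auto simp: sg_def)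
        finally show ?thesis by (simp add: r_def p_def)
      qed
      then show ?case by (simp add: crit_deriv_def p_def)
    next
      case (step j)
      then have j: "1 \<le> j" "j < n" by auto
      have IH: "\<And>v. norm v \<le> 2 * \<rho> \<Longrightarrow> norm ((f ^^ j) v - w j) \<le> r j" and IHc: "crit_deriv d a (j - 1) \<le> p j"
        using step by auto
      define y where "y = (f ^^ (j - 1)) a"
      have y: "y = (f ^^ j) 0" using j unfolding y_def
        by (metis f0 Suc_diff_1 comp_apply funpow_Suc_right less_eq_Suc_le One_nat_def)
      have "norm y \<le> norm (w j) + r j"
        using IH[of 0] \<rho> norm_triangle_sub[of y "w j"] by (simp add: y)
      then have "df y \<le> real d * (norm (w j) + r j) ^ (d - 1)" by (intro mult_left_mono power_mono) auto
      also have "\<dots> \<le> df (w j) * kp" by (rule F4[OF j])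
      finally have dfy: "df y \<le> df (w j) * kp" .
      have "crit_deriv d a j = crit_deriv d a (j - 1) * df y"
        using j unfolding crit_deriv_def y_def by (cases j) auto
      also have "\<dots> \<le> p j * (df (w j) * kp)" by (rule mult_mono[OF IHc dfy p0]) simp
      finally have c: "crit_deriv d a j \<le> p (Suc j)" using pSuc j by simp
      have err: "norm (w (Suc j) - f (w j)) \<le> kappa * theta ^ j * p (Suc j) * \<rho> ^ d"
      proof -
        have e: "norm (w (Suc j) - f (w j)) \<le> 2 * mu ^ j * z"
          using ks j unfolding kicked_seq_def by (auto dest!: spec[of _ j])
        have z: "0 \<le> z" "z \<le> \<rho> ^ d" 
          using ks \<open>0 < n\<close> unfolding kicked_seq_def \<rho>_def by (auto dest!: spec[of _ "0::nat"])
        show ?thesis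
        proof (cases "z = 0")
          case True
          have "0 \<le> kappa * theta ^ j * p (Suc j) * \<rho> ^ d" using kappa theta p0 \<rho> by simp
          then show ?thesis using e True by simp
        next
          case False
          then have "2 * mu ^ j \<le> kappa * theta ^ j * crit_deriv d a j"
            using ks unfolding kicked_seq_def by blast
          also have "\<dots> \<le> kappa * theta ^ j * p (Suc j)" using c kappa theta by (intro mult_left_mono) auto
          finally have le: "2 * mu ^ j \<le> kappa * theta ^ j * p (Suc j)" .
          have "2 * mu ^ j * z \<le> kappa * theta ^ j * p (Suc j) * \<rho> ^ d"
          proof (rule mult_mono)
            show "2 * mu ^ j \<le> kappa * theta ^ j * p (Suc j)" by (rule le)
          qed (use z kappa theta p0 in auto)
          then show ?thesis using e by linarith
        qed
      qed
      have "norm ((f ^^ Suc j) v - w (Suc j)) \<le> r (Suc j)" if v: "norm v \<le> 2 * \<rho>" for v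
      proof -
        have "norm (f ((f ^^ j) v) - f (w j)) \<le> real d * (norm (w j) + r j) ^ (d - 1) * r j"
          by (rule unicrit_ball_image[OF IH[OF v]])
        also have "\<dots> \<le> df (w j) * kp * r j" using F4[OF j] r0 by (intro mult_right_mono) auto
        also have "\<dots> = sg j * \<rho> ^ d * p (Suc j)" using pSuc[OF j(1)] by (simp add: r_def)
        finally have "norm (f ((f ^^ j) v) - f (w j)) \<le> sg j * \<rho> ^ d * p (Suc j)" .
        moreover have "(f ^^ Suc j) v - w (Suc j) = (f ((f ^^ j) v) - f (w j)) - (w (Suc j) - f (w j))" by simp
        ultimately have "norm ((f ^^ Suc j) v - w (Suc j)) \<le> sg j * \<rho> ^ d * p (Suc j) + kappa * theta ^ j * p (Suc j) * \<rho> ^ d"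
          using err by (smt (verit) norm_triangle_ineq4)
        also have "\<dots> = r (Suc j)" by (simp add: r_def sg_def algebra_simps)
        finally show ?thesis .
      qed
      then show ?case using c by simp
    qed
    have rn: "r n \<le> \<delta> * s" using late[of n] \<open>0 < n\<close> \<open>N < n\<close> by (simp add: scale_def)
    have "\<exists>v. (f ^^ n) v = v \<and> norm (deriv (f ^^ n) v) < 1"
    proof (rule nested_ball_imp_contracting_cycle[where x = 0 and \<rho> = "2 * \<rho>" and y = "w n" and r = "\<delta> * s"])
      show "norm ((f ^^ n) v - w n) \<le> \<delta> * s" if "norm (v - 0) \<le> 2 * \<rho>" for v
        using main[of n] that rn \<open>0 < n\<close> by fastforce
      show "0 < \<delta> * s" using \<delta> s by simp
      have "3 * (\<delta> * s) \<le> 1 * \<rho>" using \<delta> s mult_mono[of "3 * \<delta>" 1 s \<rho>] by (simp add: \<rho>_def)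
      then show "norm (0 - w n) + 3 * (\<delta> * s) \<le> 2 * \<rho>" using wn by (simp add: \<rho>_def)
    qed
    then show False using mult_ge_1[OF \<open>0 < n\<close>] by fastforce
  qed
  then show ?thesis using eps(1) by blast
qed

text \<open>Over a bounded time and from a contracted time on, a disc of radius proportional to \<open>|w 0|\<close> is
  contracted up to an arbitrarily small term \<open>\<eta>\<close>, provided that the errors are small.  The errors amount to
  a multiple of \<open>z\<close>, and this is also small relative to each \<open>|w j|\<close>: tameness
  gives \<open>mu ^ T * z \<le> |w j| ^ d\<close>, so that \<open>|w j|\<close> is at least of order \<open>z powr (1/d)\<close>, and \<open>d \<ge> 2\<close>.\<close>

lemma window_shadowing:
  assumes R: "1 \<le> R" and \<delta>: "0 < \<delta>" "\<delta> \<le> 1/3" "(1 + 2 * \<delta>) ^ (d - 1) \<le> kp"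
    and lam: "0 < lam1" "0 < kp" "lam1 * kp \<le> 1" and \<eta>: "0 < \<eta>"
  shows "\<exists>z0>0. \<forall>t w z. t \<le> T \<longrightarrow> 0 \<le> z \<longrightarrow> z \<le> z0 \<longrightarrow>
    (\<forall>i<t. norm (w (Suc i) - f (w i)) \<le> 2 * mu ^ i * z) \<longrightarrow> (\<forall>i\<le>t. mu ^ i * z \<le> norm (w i) ^ d) \<longrightarrow>
    (\<forall>j\<le>t. 0 < norm (w j) \<and> norm (w j) \<le> R) \<longrightarrow>
    (\<forall>j\<le>t. (\<Prod>i<j. df (w i)) * norm (w 0) \<le> lam1 ^ j * norm (w j)) \<longrightarrow>
    (\<forall>v. norm (v - w 0) \<le> \<delta> * norm (w 0) \<longrightarrow>
       norm ((f ^^ t) v - w t) \<le> \<delta> * (lam1 * kp) ^ t * norm (w t) + \<eta>)"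
proof -
  define K where "K = real d * (2 * R) ^ (d - 1)"
  have K0: "0 \<le> K" using R by (simp add: K_def)
  define X where "X = 2 * (K + 1) ^ T"
  have X: "0 < X" using K0 by (simp add: X_def)
  define z0 where "z0 = min (min 1 (\<eta> / X)) (mu ^ T * (\<delta> / X) ^ d)"
  have z0: "0 < z0" "z0 \<le> 1" "z0 \<le> \<eta> / X" "z0 \<le> mu ^ T * (\<delta> / X) ^ d"
    using X \<eta> \<delta> mu by (auto simp: z0_def)
  have "norm ((f ^^ t) v - w t) \<le> \<delta> * (lam1 * kp) ^ t * norm (w t) + \<eta>"
    if t: "t \<le> T" and z: "0 \<le> z" "z \<le> z0"
      and err: "\<forall>i<t. norm (w (Suc i) - f (w i)) \<le> 2 * mu ^ i * z"
      and tame: "\<forall>i\<le>t. mu ^ i * z \<le> norm (w i) ^ d"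
      and w: "\<forall>j\<le>t. 0 < norm (w j) \<and> norm (w j) \<le> R"
      and con: "\<forall>j\<le>t. (\<Prod>i<j. df (w i)) * norm (w 0) \<le> lam1 ^ j * norm (w j)"
      and v: "norm (v - w 0) \<le> \<delta> * norm (w 0)" for t w z v
  proof -
    have Xz: "X * z \<le> \<delta> * norm (w j)" if j: "j \<le> t" for j
    proof (rule ccontr)
      assume "\<not> ?thesis"
      then have less: "\<delta> * norm (w j) < X * z" by simp
      moreover have "0 < \<delta> * norm (w j)" using \<delta> w j by simp
      ultimately have "0 < z" using X by (meson less_trans zero_less_mult_pos)
      have "norm (w j) < (X / \<delta>) * z" using less \<delta> by (simp add: field_simps)
      then have "norm (w j) ^ d < ((X / \<delta>) * z) ^ d" using d2 by (intro power_strict_mono) auto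
      also have "\<dots> = (X / \<delta>) ^ d * z ^ d" by (rule power_mult_distrib)
      also have "\<dots> \<le> (X / \<delta>) ^ d * z ^ 2"
        using z z0 X \<delta> d2 by (intro mult_left_mono power_decreasing) auto
      finally have "norm (w j) ^ d < (X / \<delta>) ^ d * z ^ 2" .
      moreover have "mu ^ T * z \<le> mu ^ j * z"
        using mu z t j by (intro mult_right_mono power_decreasing) auto
      moreover have "mu ^ j * z \<le> norm (w j) ^ d" using tame j by blast
      ultimately have "mu ^ T * z < ((X / \<delta>) ^ d * z) * z" by (simp add: power2_eq_square)
      then have "mu ^ T < (X / \<delta>) ^ d * z" using \<open>0 < z\<close> mult_less_cancel_right_pos by blast
      also have "\<dots> \<le> (X / \<delta>) ^ d * (mu ^ T * (\<delta> / X) ^ d)"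
        using z z0 X \<delta> by (intro mult_left_mono) auto
      also have "\<dots> = mu ^ T" using X \<delta> by (simp add: power_divide)
      finally show False by simp
    qed
    \<comment> \<open>Radii are split into a contracted part \<open>p\<close> and an accumulated error \<open>x\<close>.\<close>
    define p where "p j = \<delta> * norm (w 0) * (\<Prod>i<j. df (w i) * kp)" for j
    have p0: "0 \<le> p j" for j unfolding p_def using \<delta> lam by (intro mult_nonneg_nonneg prod_nonneg) auto
    have pw: "p j \<le> \<delta> * (lam1 * kp) ^ j * norm (w j)" if "j \<le> t" for j
    proof -
      have "p j = \<delta> * kp ^ j * ((\<Prod>i<j. df (w i)) * norm (w 0))"
        by (simp add: p_def prod.distrib)
      also have "\<dots> \<le> \<delta> * kp ^ j * (lam1 ^ j * norm (w j))"
        using con that \<delta> lam by (intro mult_left_mono) auto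
      finally show ?thesis by (simp add: power_mult_distrib mult_ac)
    qed
    define x where "x j = 2 * z * (K + 1) ^ j" for j
    have x0: "0 \<le> x j" for j using z K0 by (simp add: x_def)
    have xX: "x j \<le> X * z" if "j \<le> T" for j
    proof -
      have "(K + 1) ^ j \<le> (K + 1) ^ T" using that K0 by (intro power_increasing) auto
      then show ?thesis using z by (simp add: x_def X_def mult_left_mono mult_ac)
    qed
    have "norm ((f ^^ j) v - w j) \<le> p j + x j" if "j \<le> t" for j
      using that
    proof (induction j)
      case 0
      then show ?case using v z by (simp add: p_def x_def)
    next
      case (Suc j)
      then have j: "j < t" and IH: "norm ((f ^^ j) v - w j) \<le> p j + x j" by auto
      define r where "r = p j + x j"
      define D where "D = real d * (norm (w j) + r) ^ (d - 1)"
      have wj: "0 < norm (w j)" "norm (w j) \<le> R" using w j by auto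
      have "(lam1 * kp) ^ j \<le> 1" using lam by (intro power_le_one) auto
      then have "\<delta> * (lam1 * kp) ^ j * norm (w j) \<le> \<delta> * 1 * norm (w j)"
        using \<delta> by (intro mult_right_mono mult_left_mono) auto
      then have "p j \<le> \<delta> * norm (w j)" using pw[of j] j by simp
      moreover have "x j \<le> \<delta> * norm (w j)" using xX[of j] Xz[of j] j t by simp
      ultimately have r: "r \<le> 2 * \<delta> * norm (w j)" "0 \<le> r" using p0 x0 by (auto simp: r_def)
      have D1: "D \<le> df (w j) * kp" unfolding D_def by (rule distortion_bound[OF r \<delta>(3)])
      have "2 * \<delta> * norm (w j) \<le> 1 * R" by (rule mult_mono) (use \<delta> wj in auto)
      then have D2: "D \<le> K" unfolding D_def K_def using r wj
        by (intro mult_left_mono power_mono) auto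
      have "norm (f ((f ^^ j) v) - f (w j)) \<le> D * r"
        unfolding D_def by (rule unicrit_ball_image) (use IH r_def in simp)
      also have "\<dots> = D * p j + D * x j" by (simp add: r_def distrib_left)
      also have "\<dots> \<le> (df (w j) * kp) * p j + K * x j"
        using D1 D2 p0 x0 by (intro add_mono mult_right_mono) auto
      finally have A: "norm (f ((f ^^ j) v) - f (w j)) \<le> p (Suc j) + K * x j"
        by (simp add: p_def mult_ac)
      have "norm (w (Suc j) - f (w j)) \<le> 2 * mu ^ j * z" using err j by blast
      also have "\<dots> \<le> 2 * 1 * z"
        using z mu by (intro mult_right_mono mult_left_mono power_le_one) auto
      also have "\<dots> \<le> x j"
        using z K0 one_le_power[of "K + 1" j] mult_left_mono[of 1 "(K + 1) ^ j" "2 * z"] by (simp add: x_def)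
      finally have B: "norm (w (Suc j) - f (w j)) \<le> x j" .
      have "(f ^^ Suc j) v - w (Suc j) = (f ((f ^^ j) v) - f (w j)) - (w (Suc j) - f (w j))" by simp
      then have "norm ((f ^^ Suc j) v - w (Suc j)) \<le> p (Suc j) + K * x j + x j"
        using A B by (smt (verit) norm_triangle_ineq4)
      also have "\<dots> = p (Suc j) + x (Suc j)" by (simp add: x_def algebra_simps)
      finally show ?case .
    qed
    then have "norm ((f ^^ t) v - w t) \<le> p t + x t" by simp
    moreover have "x t \<le> \<eta>"
    proof -
      have "X * z \<le> X * (\<eta> / X)" using z z0 X by (intro mult_left_mono) auto
      then show ?thesis using xX[OF t] X by simp
    qed
    ultimately show ?thesis using pw[of t] by simp
  qed
  then show ?thesis using z0(1) by blast
qed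

section \<open>Lower bounds for the derivative\<close>

lemma contracted_shift:
  assumes "contracted lam n w s q" "q < n"
  shows "contracted lam (n - q) (\<lambda>i. w (q + i)) s 0"
  unfolding contracted_def
proof (intro allI impI)
  fix j assume j: "0 < j \<and> j \<le> n - q"
  have "(\<Prod>i=0..<j. df (w (q + i))) = (\<Prod>i=q..<q + j. df (w i))"
    using prod.shift_bounds_nat_ivl[of "\<lambda>i. df (w i)" 0 q j] by (simp add: add.commute)
  moreover have "(\<Prod>i=q..<q + j. df (w i)) * scale n w s q \<le> lam ^ (q + j - q) * scale n w s (q + j)"
    by (rule assms(1)[unfolded contracted_def, rule_format]) (use j in auto)
  moreover have "scale (n - q) (\<lambda>i. w (q + i)) s i = scale n w s (q + i)" for i
    by (auto simp: scale_def)
  ultimately show "(\<Prod>i=0..<j. df (w (q + i))) * scale (n - q) (\<lambda>i. w (q + i)) s 0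
      \<le> lam ^ (j - 0) * scale (n - q) (\<lambda>i. w (q + i)) s j" by simp
qed

text \<open>The hypothesis on points closer than \<open>eps\<close> to 0 is what \<open>no_contracting_close_return\<close> needs in order to exclude
  contracted times there.  It is void for orbits that stay away from 0, and it also holds for an orbit
  segment that ends at its first return to the disc of radius \<open>s = |w 0|\<close>.\<close>

lemma derivative_lower_bound:
  assumes R: "1 \<le> R" and lam0: "0 < lam0" "lam0 < 1"
  shows "\<exists>eps0>0. \<forall>eps. 0 < eps \<and> eps \<le> eps0 \<longrightarrow> (\<exists>C>0. \<forall>n w z s. kicked_seq n w z \<longrightarrow> 0 < n \<longrightarrow>
    (\<forall>j<n. 0 < norm (w j) \<and> norm (w j) \<le> R) \<longrightarrow> 0 < s \<longrightarrow> s \<le> R \<longrightarrow>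
    (\<forall>j<n. norm (w j) < eps \<longrightarrow> norm (w n) \<le> norm (w j) \<and> s \<le> norm (w j)) \<longrightarrow>
    C * lam0 ^ n * s \<le> (\<Prod>i<n. df (w i)) * norm (w 0))"
proof -
  define lam1 where "lam1 = sqrt lam0"
  have sq: "sqrt x < 1" "x < sqrt x" if "0 < x" "x < 1" for x :: real
  proof -
    show 1: "sqrt x < 1" using that by simp
    have "sqrt x * sqrt x < sqrt x * 1" using that 1 by (intro mult_strict_left_mono) auto
    then show "x < sqrt x" using that by simp
  qed
  have lam1: "0 < lam1" "lam1 < 1" "lam0 < lam1" using sq[OF lam0] lam0 by (auto simp: lam1_def)
  define lam2 where "lam2 = sqrt lam1"
  have lam2: "0 < lam2" "lam2 < 1" "lam1 < lam2" using sq[of lam1] lam1 by (auto simp: lam2_def)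
  define kp where "kp = 1 / lam2"
  have kp: "1 < kp" using lam2 by (simp add: kp_def)
  have lk: "lam1 * kp = lam2" using lam1 lam2 real_sqrt_mult_self[of lam1]
    by (simp add: kp_def lam2_def field_simps)
  obtain \<delta> where \<delta>: "0 < \<delta>" "\<delta> \<le> 1/3" "(1 + 2 * \<delta>) ^ (d - 1) \<le> kp"
    using exists_small_distortion[OF kp] by blast
  from no_contracting_close_return[OF R lam1(1,2)] obtain eps0 where eps0: "0 < eps0" and
    close: "\<forall>n w z s. kicked_seq n w z \<longrightarrow> 0 < n \<longrightarrow> (\<forall>j<n. 0 < norm (w j) \<and> norm (w j) \<le> R) \<longrightarrow>
    norm (w 0) < eps0 \<longrightarrow> norm (w n) \<le> norm (w 0) \<longrightarrow> 0 < s \<longrightarrow> s \<le> norm (w 0) \<longrightarrow>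
    \<not> contracted lam1 n w s 0" by (elim exE conjE)
  have "\<exists>C>0. \<forall>n w z s. kicked_seq n w z \<longrightarrow> 0 < n \<longrightarrow>
    (\<forall>j<n. 0 < norm (w j) \<and> norm (w j) \<le> R) \<longrightarrow> 0 < s \<longrightarrow> s \<le> R \<longrightarrow>
    (\<forall>j<n. norm (w j) < eps \<longrightarrow> norm (w n) \<le> norm (w j) \<and> s \<le> norm (w j)) \<longrightarrow>
    C * lam0 ^ n * s \<le> (\<Prod>i<n. df (w i)) * norm (w 0)" if eps: "0 < eps" "eps \<le> eps0" for eps
  proof -
    define e where "e = \<delta> * eps / 16"
    have e: "0 < e" using \<delta> eps by (simp add: e_def)
    obtain G0 where G0: "lam2 ^ G0 < eps / (16 * R)"
      using real_arch_pow_inv[of "eps / (16 * R)" lam2] eps R lam2 by auto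
    define G where "G = Suc G0"
    have "lam2 ^ G \<le> lam2 ^ G0" using lam2 by (intro power_decreasing) (auto simp: G_def)
    then have G: "lam2 ^ G \<le> eps / (16 * R)" "0 < G" using G0 by (auto simp: G_def)
    obtain L where L: "\<forall>H (w :: nat \<Rightarrow> complex). L < card H \<longrightarrow> (\<forall>q\<in>H. norm (w q) \<le> R) \<longrightarrow>
      (\<exists>q\<in>H. \<exists>q'\<in>H. q + G \<le> q' \<and> norm (w q - w q') \<le> 2 * e)"
      using separated_close_pair[of "2 * e" G R] e G by auto
    define B where "B = max 1 (ln (R / eps ^ d))"
    have B: "1 \<le> B" "ln (R / eps ^ d) \<le> B" by (auto simp: B_def)
    define \<gamma> where "\<gamma> = ln (lam1 / lam0)"
    have \<gamma>: "0 < \<gamma>" using lam1 lam0 by (simp add: \<gamma>_def)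
    obtain T where T: "real L * B / \<gamma> < real T" using reals_Archimedean2 by blast
    have "0 \<le> real L * B / \<gamma>" using B \<gamma> by simp
    then have T0: "0 < T" using T by (cases T) auto
    have LT: "real L / real T * B \<le> \<gamma>" using T T0 \<gamma> by (simp add: field_simps)
    have lk1: "lam1 * kp \<le> 1" using lk lam2 by simp
    have kp0: "0 < kp" using kp by simp
    from window_shadowing[OF R \<delta> lam1(1) kp0 lk1 e, of T]
    obtain z0 where z0: "0 < z0" and shadow: "\<forall>t w z. t \<le> T \<longrightarrow> 0 \<le> z \<longrightarrow> z \<le> z0 \<longrightarrow>
      (\<forall>i<t. norm (w (Suc i) - f (w i)) \<le> 2 * mu ^ i * z) \<longrightarrow> (\<forall>i\<le>t. mu ^ i * z \<le> norm (w i) ^ d) \<longrightarrow>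
      (\<forall>j\<le>t. 0 < norm (w j) \<and> norm (w j) \<le> R) \<longrightarrow>
      (\<forall>j\<le>t. (\<Prod>i<j. df (w i)) * norm (w 0) \<le> lam1 ^ j * norm (w j)) \<longrightarrow>
      (\<forall>v. norm (v - w 0) \<le> \<delta> * norm (w 0) \<longrightarrow>
         norm ((f ^^ t) v - w t) \<le> \<delta> * (lam1 * kp) ^ t * norm (w t) + e)"
      by (elim exE conjE)
    obtain M0 where M0: "mu ^ M0 < z0" using real_arch_pow_inv[OF z0 mu(2)] by blast
    define M where "M = Suc M0"
    have "mu ^ M \<le> mu ^ M0" using mu by (intro power_decreasing) (auto simp: M_def)
    then have M: "mu ^ M \<le> z0" "0 < M" using M0 by (auto simp: M_def)
    \<comment> \<open>Each window of length \<open>T\<close> after time \<open>M\<close> will contain at most \<open>L\<close> contracted times, each of which accounts for a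
  loss of at most \<open>B\<close>.  The length \<open>T\<close> is chosen so that the windows account for the factor
  \<open>(lam0 / lam1) ^ n\<close>; the remaining loss is \<open>B * (M + L)\<close>.\<close>
    define C where "C = exp (- (B * (M + L)))"
    have "C * lam0 ^ n * s \<le> (\<Prod>i<n. df (w i)) * norm (w 0)"
      if ks: "kicked_seq n w z" and n: "0 < n" and w: "\<forall>j<n. 0 < norm (w j) \<and> norm (w j) \<le> R"
        and s: "0 < s" "s \<le> R"
        and small: "\<forall>j<n. norm (w j) < eps \<longrightarrow> norm (w n) \<le> norm (w j) \<and> s \<le> norm (w j)"
      for n w z s
    proof (rule ccontr)
      assume "\<not> ?thesis"
      then have contra: "(\<Prod>i<n. df (w i)) * norm (w 0) < C * lam0 ^ n * s" by simp
      have z: "0 \<le> z" "z \<le> 1" using ks unfolding kicked_seq_def by auto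
      define P where "P j = (\<Prod>i<j. df (w i))" for j
      have P0: "0 < P j" if "j \<le> n" for j
        unfolding P_def using that d2 w by (intro prod_pos) auto
      have Psplit: "P j = P q * (\<Prod>i=q..<j. df (w i))" if "q \<le> j" for q j
        unfolding P_def using that by (metis prod.atLeastLessThan_concat lessThan_atLeast0 le0)
      have u0: "0 < scale n w s j" for j using w s by (simp add: scale_def)
      have uR: "scale n w s j \<le> R" for j using w s by (simp add: scale_def)
      \<comment> \<open>Right maxima of \<open>X\<close> are exactly the contracted times with rate \<open>lam1\<close>, since the increment of \<open>X\<close>
  over one step is the logarithm of the relative derivative minus \<open>ln lam1\<close>.\<close>
      define X where "X j = ln (P j / scale n w s j) - real j * ln lam1" for j
      define H where "H = {q. q < n \<and> (\<forall>j. q < j \<and> j \<le> n \<longrightarrow> X j \<le> X q)}"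
      have con: "contracted lam1 n w s q" if q: "q \<in> H" for q
        unfolding contracted_def
      proof (intro allI impI)
        fix j assume j: "q < j \<and> j \<le> n"
        then have "X j \<le> X q" using q by (auto simp: H_def)
        then have "ln (P j / scale n w s j) \<le> ln (P q / scale n w s q) + (real j - real q) * ln lam1"
          unfolding X_def by (simp add: algebra_simps)
        also have "\<dots> = ln (P q / scale n w s q * lam1 ^ (j - q))"
        proof -
          have "ln (A * lam1 ^ (j - q)) = ln A + (real j - real q) * ln lam1" if "0 < A" for A
            using j that lam1 by (simp add: ln_mult ln_realpow of_nat_diff)
          moreover have "0 < P q / scale n w s q" using j P0[of q] u0[of q] by simp
          ultimately show ?thesis by (simp only:)
        qed
        finally have "P j / scale n w s j \<le> P q / scale n w s q * lam1 ^ (j - q)"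
          using j P0[of q] P0[of j] u0[of q] u0[of j] lam1 by (subst (asm) ln_le_cancel_iff) auto
        then have "P q * (\<Prod>i=q..<j. df (w i)) / scale n w s j \<le> P q / scale n w s q * lam1 ^ (j - q)"
          using Psplit[of q j] j by simp
        then have "P q * ((\<Prod>i=q..<j. df (w i)) / scale n w s j) \<le> P q * (lam1 ^ (j - q) / scale n w s q)"
          by (simp add: mult_ac)
        then have "(\<Prod>i=q..<j. df (w i)) / scale n w s j \<le> lam1 ^ (j - q) / scale n w s q"
          by (rule mult_left_le_imp_le) (use P0[of q] j in simp)
        then show "(\<Prod>i=q..<j. df (w i)) * scale n w s q \<le> lam1 ^ (j - q) * scale n w s j"
          using u0[of q] u0[of j] by (simp only: pos_divide_le_eq pos_le_divide_eq times_divide_eq_left)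
      qed
      have large: "eps \<le> norm (w q)" if q: "q \<in> H" for q
      proof (rule ccontr)
        assume "\<not> ?thesis"
        then have less: "norm (w q) < eps" by simp
        have qn: "q < n" using q by (simp add: H_def)
        have "\<not> contracted lam1 (n - q) (\<lambda>i. w (q + i)) s 0"
          by (rule close[rule_format, OF kicked_shift[OF ks less_imp_le[OF qn]]])
            (use qn less w small s eps in auto)
        then show False using contracted_shift[OF con[OF q] qn] by simp
      qed
      have drop: "X q - X (Suc q) \<le> B" if q: "q < n" "\<forall>j. q < j \<and> j \<le> n \<longrightarrow> X j \<le> X q" for q
      proof -
        have qH: "q \<in> H" using q by (simp add: H_def)
        have dfq: "0 < df (w q)" using d2 w q by simp
        have PS: "P (Suc q) = P q * df (w q)" by (simp add: P_def)
        have "eps ^ d \<le> norm (w q) ^ d" using large[OF qH] eps by (intro power_mono) auto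
        also have "\<dots> = norm (w q) ^ (d - 1) * norm (w q)"
          using d2 by (metis One_nat_def Suc_1 Suc_le_D diff_Suc_1 power_Suc2)
        also have "\<dots> \<le> df (w q) * norm (w q)"
          using d2 mult_right_mono[of 1 "real d" "norm (w q) ^ (d - 1)"] by (intro mult_right_mono) auto
        finally have ed: "eps ^ d \<le> df (w q) * scale n w s q" using q by (simp add: scale_def)
        have "X q - X (Suc q) = ln (P q / scale n w s q) - ln (P (Suc q) / scale n w s (Suc q)) + ln lam1"
          unfolding X_def by (simp add: algebra_simps)
        also have "\<dots> \<le> ln (P q / scale n w s q) - ln (P (Suc q) / scale n w s (Suc q))"
          using lam1 by simp
        also have "\<dots> = ln ((P q / scale n w s q) / (P (Suc q) / scale n w s (Suc q)))"
          using P0[of q] P0[of "Suc q"] u0[of q] u0[of "Suc q"] q by (subst (3) ln_divide_pos) auto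
        also have "(P q / scale n w s q) / (P (Suc q) / scale n w s (Suc q)) = scale n w s (Suc q) / (df (w q) * scale n w s q)"
          using P0[of q] dfq u0[of q] u0[of "Suc q"] q unfolding PS by (simp add: field_simps)
        also have "ln \<dots> \<le> ln (R / eps ^ d)"
        proof (subst ln_le_cancel_iff)
          show "scale n w s (Suc q) / (df (w q) * scale n w s q) \<le> R / eps ^ d"
            using ed eps uR[of "Suc q"] u0[of "Suc q"] R by (intro frac_le) auto
        qed (use u0 dfq R eps in auto)
        also have "\<dots> \<le> B" by (rule B)
        finally show ?thesis .
      qed
      have window: "card (H \<inter> {m..<m + T}) \<le> L" if m: "M \<le> m" for m
      proof (rule ccontr)
        assume "\<not> ?thesis"
        then have "L < card (H \<inter> {m..<m + T})" by simp
        moreover have "\<forall>q\<in>H \<inter> {m..<m + T}. norm (w q) \<le> R" using w by (auto simp: H_def)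
        ultimately obtain q q' where q: "q \<in> H" "q' \<in> H" "m \<le> q" "q' < m + T" "q + G \<le> q'"
          and near: "norm (w q - w q') \<le> 2 * e" using L[rule_format, of "H \<inter> {m..<m + T}" w] by auto
        define t where "t = q' - q"
        have t: "t \<le> T" "G \<le> t" "0 < t" "q + t = q'" "q' < n" using q G by (auto simp: t_def H_def)
        have q0: "0 < q" "q \<le> n" using q m M t by auto
        have tail: "tame_seq (n - q) (\<lambda>i. w (q + i)) (mu ^ q * z)"
          by (rule kicked_tail[OF ks q0])
        have maps: "norm ((f ^^ t) v - w q') \<le> 2 * e" if v: "norm (v - w q) \<le> \<delta> * norm (w q)" for v
        proof -
          have "norm ((f ^^ t) v - w (q + t)) \<le> \<delta> * (lam1 * kp) ^ t * norm (w (q + t)) + e"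
          proof (rule shadow[rule_format, where w = "\<lambda>i. w (q + i)" and z = "mu ^ q * z"])
            show "t \<le> T" by fact
            show "0 \<le> mu ^ q * z" using mu z by simp
            have "mu ^ q * z \<le> mu ^ M * 1" using mu z q m by (intro mult_mono power_decreasing) auto
            then show "mu ^ q * z \<le> z0" using M by simp
            show "norm (w (q + Suc i) - f (w (q + i))) \<le> 2 * mu ^ i * (mu ^ q * z)" if "i < t" for i
              using tail that t unfolding tame_seq_def by (auto dest!: spec[of _ i])
            show "mu ^ i * (mu ^ q * z) \<le> norm (w (q + i)) ^ d" if "i \<le> t" for i
              using tail that t unfolding tame_seq_def by (auto dest!: spec[of _ i])
            show "0 < norm (w (q + j)) \<and> norm (w (q + j)) \<le> R" if "j \<le> t" for j
              using w that t by auto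
            show "(\<Prod>i<j. df (w (q + i))) * norm (w (q + 0)) \<le> lam1 ^ j * norm (w (q + j))" if j: "j \<le> t" for j
            proof (cases "j = 0")
              case False
              have "contracted lam1 (n - q) (\<lambda>i. w (q + i)) s 0"
                by (rule contracted_shift[OF con[OF q(1)]]) (use t q in auto)
              moreover have "j < n - q" "q < n" using j t by linarith+
              ultimately show ?thesis using False
                unfolding contracted_def by (auto simp: scale_def atLeast0LessThan dest!: spec[of _ j])
            qed simp
            show "norm (v - w (q + 0)) \<le> \<delta> * norm (w (q + 0))" using v by simp
          qed
          also have "\<delta> * (lam1 * kp) ^ t * norm (w (q + t)) \<le> \<delta> * (eps / (16 * R)) * R"
          proof (rule mult_mono)
            have "(lam1 * kp) ^ t \<le> lam2 ^ G" unfolding lk using lam2 t by (intro power_decreasing) auto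
            then show "\<delta> * (lam1 * kp) ^ t \<le> \<delta> * (eps / (16 * R))" using G \<delta> by (intro mult_left_mono) auto
            show "norm (w (q + t)) \<le> R" using w t by auto
          qed (use \<delta> eps R in auto)
          also have "\<dots> = e" using R by (simp add: e_def)
          finally show ?thesis using t by simp
        qed
        \<comment> \<open>The value \<open>e = \<delta> * eps / 16\<close> makes \<open>2 * e + 3 * (2 * e)\<close> at most half the radius.\<close>
        have "\<exists>v. (f ^^ t) v = v \<and> norm (deriv (f ^^ t) v) < 1"
        proof (rule nested_ball_imp_contracting_cycle[where y = "w q'" and x = "w q" and r = "2 * e", OF maps])
          have "\<delta> * eps \<le> \<delta> * norm (w q)" using large[OF q(1)] \<delta> by (intro mult_left_mono) auto
          then show "norm (w q - w q') + 3 * (2 * e) \<le> \<delta> * norm (w q)" using near e by (simp add: e_def)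
        qed (use e in auto)
        then show False using mult_ge_1[OF t(3)] by fastforce
      qed
      have HT: "H \<subseteq> {..<n}" by (auto simp: H_def)
      have "card H \<le> M + (n div T + 1) * L" using card_le_of_windows[OF HT T0, where M = M and L = L] window by blast
      then have "real (card H) \<le> real (M + (n div T + 1) * L)" using of_nat_le_iff by blast
      also have "\<dots> = real M + real L + real (n div T) * real L" by (simp add: algebra_simps)
      also have "real (n div T) \<le> real n / real T" 
      proof -
        have "real (n div T) * real T \<le> real n" by (metis of_nat_mult of_nat_le_iff div_times_less_eq_dividend)
        then show ?thesis using T0 by (simp add: pos_le_divide_eq)
      qed
      finally have "real (card H) \<le> real M + real L + real n / real T * real L"
        by (simp add: mult_right_mono)
      then have "B * real (card H) \<le> B * (real M + real L + real n / real T * real L)"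
        using B by (intro mult_left_mono) auto
      also have "\<dots> = B * (M + L) + real n * (real L / real T * B)" by (simp add: algebra_simps)
      also have "\<dots> \<le> B * (M + L) + real n * \<gamma>" using LT by (intro add_left_mono mult_left_mono) auto
      finally have "B * real (card H) \<le> B * (M + L) + real n * \<gamma>" .
      moreover have "X 0 - X n \<le> B * real (card H)"
        unfolding H_def by (rule drop_le_card_right_maxima) (use drop B in auto)
      moreover have "B * (M + L) + real n * \<gamma> < X 0 - X n"
      proof -
        have "ln (P n * norm (w 0) / s) < ln (C * lam0 ^ n)"
        proof (subst ln_less_cancel_iff)
          show "P n * norm (w 0) / s < C * lam0 ^ n" using contra s by (simp add: P_def pos_divide_less_eq)
        qed (use P0[of n] w n s lam0 in \<open>auto simp: C_def\<close>)
        also have "\<dots> = - (B * (M + L)) + real n * ln lam0"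
          using lam0 by (simp add: ln_mult ln_realpow C_def)
        finally have 1: "ln (P n * norm (w 0) / s) < - (B * (M + L)) + real n * ln lam0" .
        have "X 0 - X n = - ln (norm (w 0)) - ln (P n / s) + real n * ln lam1"
          using w n by (simp add: X_def P_def scale_def ln_div)
        moreover have "ln (P n * norm (w 0) / s) = ln (P n / s) + ln (norm (w 0))"
          using P0[of n] w n s by (simp add: ln_mult ln_div)
        moreover have "real n * \<gamma> = real n * ln lam1 - real n * ln lam0"
          using lam1 lam0 by (simp add: \<gamma>_def ln_div right_diff_distrib)
        ultimately show ?thesis using 1 by (simp add: algebra_simps)
      qed
      ultimately show False by linarith
    qed
    moreover have "0 < C" by (simp add: C_def)
    ultimately show ?thesis by blast
  qed
  then show ?thesis using eps0 by blast
qed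

lemma escape_step:
  assumes ts: "tame_seq n w z" and R: "norm a + 3 \<le> R" and j: "j < n" "R < norm (w j)"
  shows "norm (w j) < norm (w (Suc j))"
proof -
  have "norm (w (Suc j) - f (w j)) \<le> 2 * mu ^ j * z" using ts j unfolding tame_seq_def by blast
  also have "\<dots> \<le> 2 * 1 * 1"
    using ts mu unfolding tame_seq_def by (intro mult_mono power_le_one) auto
  finally have e: "norm (w (Suc j) - f (w j)) \<le> 2" by simp
  define x where "x = norm (w j)"
  have x: "norm a + 3 < x" using R j by (simp add: x_def)
  then have x1: "1 \<le> x" using norm_ge_zero[of a] by linarith
  have "x ^ 2 \<le> norm (w j ^ d)" using x1 d2 by (simp add: norm_power x_def power_increasing)
  moreover have "x * 3 + x * norm a \<le> x * x"
    using x x1 mult_left_mono[of "norm a + 3" x x] by (simp add: algebra_simps)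
  moreover have "norm a \<le> x * norm a" using x1 by (simp add: mult_le_cancel_right1)
  ultimately have A: "norm a + 3 * x \<le> norm (w j ^ d)" by (simp add: power2_eq_square)
  have "w j ^ d = w (Suc j) - (w (Suc j) - f (w j)) - a" by (simp add: unicrit_def)
  then have "norm (w j ^ d) \<le> norm (w (Suc j)) + norm (w (Suc j) - f (w j)) + norm a"
    by (smt (verit) norm_triangle_ineq4)
  then have "norm a + 3 * x \<le> norm (w (Suc j)) + 2 + norm a" using A e by linarith
  moreover have "1 < x" using x norm_ge_zero[of a] by linarith
  ultimately show ?thesis unfolding x_def by linarith
qed

lemma escape_mono:
  assumes ts: "tame_seq n w z" and R: "norm a + 3 \<le> R" and j: "R < norm (w j)" and i: "j \<le> i" "i \<le> n"
  shows "norm (w j) \<le> norm (w i) \<and> (j < i \<longrightarrow> norm (w j) < norm (w i))"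
  using i
proof (induction i rule: dec_induct)
  case (step i)
  then have "norm (w j) \<le> norm (w i)" by simp
  then show ?case using escape_step[OF ts R, of i] step j by simp
qed simp

text \<open>The second bound has no constant: the segment returns to a disc of radius \<open>|w 0| < e\<close>, so its length
  exceeds the number \<open>N\<close> after which the constant of \<open>derivative_lower_bound\<close> is outweighed by the passage from the
  rate \<open>lamG\<close> to \<open>lam\<close>.  This is what makes it possible to chain returns.\<close>

lemma return_bounds:
  assumes R: "1 \<le> R" and lam: "0 < lam" "lam < 1"
  shows "\<exists>e>0. \<exists>C>0. 
    (\<forall>n w z. kicked_seq n w z \<longrightarrow> 0 < n \<longrightarrow> (\<forall>j<n. e \<le> norm (w j) \<and> norm (w j) \<le> R) \<longrightarrow>
       C * lam ^ n \<le> (\<Prod>i<n. df (w i))) \<and>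
    (\<forall>n w z. kicked_seq n w z \<longrightarrow> 0 < n \<longrightarrow> (\<forall>j<n. norm (w 0) \<le> norm (w j) \<and> norm (w j) \<le> R) \<longrightarrow>
       0 < norm (w 0) \<longrightarrow> norm (w 0) < e \<longrightarrow> norm (w n) \<le> norm (w 0) \<longrightarrow>
       lam ^ n \<le> (\<Prod>i<n. df (w i)))"
proof -
  define lamG where "lamG = sqrt lam"
  have lamG: "0 < lamG" "lamG < 1" "lam = lamG * lamG" using lam by (auto simp: lamG_def)
  have lam_le: "lam \<le> lamG" using lamG mult_left_mono[of lamG 1 lamG] by simp
  from derivative_lower_bound[OF R lamG(1,2)] obtain eps0 where eps0: "0 < eps0" and
   G: "\<forall>eps. 0 < eps \<and> eps \<le> eps0 \<longrightarrow> (\<exists>C>0. \<forall>n w z s. kicked_seq n w z \<longrightarrow> 0 < n \<longrightarrow>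
    (\<forall>j<n. 0 < norm (w j) \<and> norm (w j) \<le> R) \<longrightarrow> 0 < s \<longrightarrow> s \<le> R \<longrightarrow>
    (\<forall>j<n. norm (w j) < eps \<longrightarrow> norm (w n) \<le> norm (w j) \<and> s \<le> norm (w j)) \<longrightarrow>
    C * lamG ^ n * s \<le> (\<Prod>i<n. df (w i)) * norm (w 0))" by (elim exE conjE)
  from G[rule_format, OF conjI[OF eps0 order_refl]] obtain C1 where C1: "0 < C1" and
   G1: "\<forall>n w z s. kicked_seq n w z \<longrightarrow> 0 < n \<longrightarrow>
    (\<forall>j<n. 0 < norm (w j) \<and> norm (w j) \<le> R) \<longrightarrow> 0 < s \<longrightarrow> s \<le> R \<longrightarrow>
    (\<forall>j<n. norm (w j) < eps0 \<longrightarrow> norm (w n) \<le> norm (w j) \<and> s \<le> norm (w j)) \<longrightarrow>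
    C1 * lamG ^ n * s \<le> (\<Prod>i<n. df (w i)) * norm (w 0)" by (elim exE conjE)
  obtain N where N: "lamG ^ N < C1" using real_arch_pow_inv[OF C1 lamG(2)] by blast
  from late_return[OF R, of N] obtain b \<epsilon> where b: "0 < b" and \<epsilon>: "0 < \<epsilon>" "\<epsilon> < b"
    and far: "\<forall>n w z. kicked_seq n w z \<longrightarrow> (\<forall>j<n. norm (w j) \<le> R) \<longrightarrow> norm (w 0) < \<epsilon> \<longrightarrow>
     (\<forall>j. 0 < j \<and> j \<le> n \<and> j \<le> N \<longrightarrow> b \<le> norm (w j))"
    by (elim exE conjE)
  define e where "e = min \<epsilon> eps0"
  have e: "0 < e" "e \<le> \<epsilon>" "e \<le> eps0" using \<epsilon> eps0 by (auto simp: e_def)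
  from G[rule_format, OF conjI[OF e(1,3)]] obtain C2 where C2: "0 < C2" and
   G2: "\<forall>n w z s. kicked_seq n w z \<longrightarrow> 0 < n \<longrightarrow>
    (\<forall>j<n. 0 < norm (w j) \<and> norm (w j) \<le> R) \<longrightarrow> 0 < s \<longrightarrow> s \<le> R \<longrightarrow>
    (\<forall>j<n. norm (w j) < e \<longrightarrow> norm (w n) \<le> norm (w j) \<and> s \<le> norm (w j)) \<longrightarrow>
    C2 * lamG ^ n * s \<le> (\<Prod>i<n. df (w i)) * norm (w 0)" by (elim exE conjE)
  have "C2 / R * lam ^ n \<le> (\<Prod>i<n. df (w i))"
    if ks: "kicked_seq n w z" "0 < n" and w: "\<forall>j<n. e \<le> norm (w j) \<and> norm (w j) \<le> R" for n w z
  proof -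
    have p0: "0 \<le> (\<Prod>i<n. df (w i))" by (intro prod_nonneg) auto
    have "C2 * lamG ^ n * 1 \<le> (\<Prod>i<n. df (w i)) * norm (w 0)"
      by (rule G2[rule_format, OF ks]) (use w e R in \<open>force+\<close>)
    also have "\<dots> \<le> (\<Prod>i<n. df (w i)) * R" using p0 w ks by (intro mult_left_mono) auto
    finally have "C2 * lamG ^ n / R \<le> (\<Prod>i<n. df (w i))" using R by (simp add: pos_divide_le_eq)
    moreover have "C2 * lam ^ n / R \<le> C2 * lamG ^ n / R"
      using C2 R lam lam_le by (intro divide_right_mono mult_left_mono power_mono) auto
    ultimately show ?thesis by simp
  qed
  moreover have "lam ^ n \<le> (\<Prod>i<n. df (w i))"
    if ks: "kicked_seq n w z" "0 < n" and w: "\<forall>j<n. norm (w 0) \<le> norm (w j) \<and> norm (w j) \<le> R"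
      and w0: "0 < norm (w 0)" "norm (w 0) < e" and wn: "norm (w n) \<le> norm (w 0)" for n w z
  proof -
    have "N < n"
    proof (rule ccontr)
      assume "\<not> N < n"
      then have "b \<le> norm (w n)"
        by (intro far[rule_format, OF ks(1)]) (use w w0 e ks in auto)
      then show False using wn w0 e \<epsilon> by linarith
    qed
    have "C1 * lamG ^ n * norm (w 0) \<le> (\<Prod>i<n. df (w i)) * norm (w 0)"
      by (rule G1[rule_format, OF ks]) (use w w0 wn ks in \<open>force+\<close>)
    then have "C1 * lamG ^ n \<le> (\<Prod>i<n. df (w i))" using w0 by (simp only: mult_le_cancel_right_pos)
    moreover have "lamG ^ n * lamG ^ n \<le> C1 * lamG ^ n"
    proof (rule mult_right_mono)
      have "lamG ^ n \<le> lamG ^ N" using lamG \<open>N < n\<close> by (intro power_decreasing) auto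
      then show "lamG ^ n \<le> C1" using N by linarith
    qed (use lamG in auto)
    ultimately show ?thesis by (simp add: lamG(3) power_mult_distrib)
  qed
  moreover have "0 < C2 / R" using C2 R by simp
  ultimately show ?thesis using e(1) by blast
qed

lemma prod_split_at:
  fixes g :: "nat \<Rightarrow> real"
  assumes "m \<le> n"
  shows "(\<Prod>i<n. g i) = (\<Prod>i<m. g i) * (\<Prod>i<n - m. g (m + i))"
proof -
  have "(\<Prod>i<m + k. g i) = (\<Prod>i<m. g i) * (\<Prod>i<k. g (m + i))" for k
    by (induction k) (auto simp: mult_ac)
  from this[of "n - m"] show ?thesis using assms by simp
qed

text \<open>Up to the first time when the orbit is closer than \<open>e\<close> to 0 use the first part of
  \<open>return_bounds\<close>.  From then on cut the orbit at the successive times when it is at least as close to 0 as ever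
  before; the last of these is \<open>n\<close>, and every piece satisfies the second part.\<close>

lemma closest_return_bound:
  assumes lam: "0 < lam" "lam < 1"
  shows "\<exists>C>0. \<forall>n w z. tame_seq n w z \<longrightarrow> (\<forall>j<n. 0 < norm (w j)) \<longrightarrow> (\<forall>j<n. norm (w n) \<le> norm (w j)) \<longrightarrow>
    C * lam ^ n \<le> (\<Prod>i<n. df (w i))"
proof -
  define R where "R = norm a + 3"
  have R: "1 \<le> R" "norm a + 3 \<le> R" by (auto simp: R_def)
  from return_bounds[OF R(1) lam] obtain e C2 where e: "0 < e" and C2: "0 < C2"
    and A: "\<forall>n w z. kicked_seq n w z \<longrightarrow> 0 < n \<longrightarrow> (\<forall>j<n. e \<le> norm (w j) \<and> norm (w j) \<le> R) \<longrightarrow>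
       C2 * lam ^ n \<le> (\<Prod>i<n. df (w i))"
    and B: "\<forall>n w z. kicked_seq n w z \<longrightarrow> 0 < n \<longrightarrow> (\<forall>j<n. norm (w 0) \<le> norm (w j) \<and> norm (w j) \<le> R) \<longrightarrow>
       0 < norm (w 0) \<longrightarrow> norm (w 0) < e \<longrightarrow> norm (w n) \<le> norm (w 0) \<longrightarrow>
       lam ^ n \<le> (\<Prod>i<n. df (w i))" by (elim exE conjE)
  have bd: "norm (w j) \<le> R" if "tame_seq n w z" "\<forall>j<n. norm (w n) \<le> norm (w j)" "j < n" for n w z j
    using escape_mono[OF that(1) R(2), of j n] that by force
  have chain: "lam ^ n \<le> (\<Prod>i<n. df (w i))"
    if "tame_seq n w z" "\<forall>j<n. 0 < norm (w j)" "\<forall>j<n. norm (w n) \<le> norm (w j)" "norm (w 0) < e" for n w z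
    using that
  proof (induction n arbitrary: w z rule: less_induct)
    case (less n)
    show ?case
    proof (cases "n = 0")
      case False
      define m where "m = (LEAST j. 0 < j \<and> norm (w j) \<le> norm (w 0))"
      have ex: "0 < n \<and> norm (w n) \<le> norm (w 0)" using less.prems False by simp
      have m: "0 < m" "norm (w m) \<le> norm (w 0)" "m \<le> n"
        using LeastI[of "\<lambda>j. 0 < j \<and> norm (w j) \<le> norm (w 0)", OF ex] 
          Least_le[of "\<lambda>j. 0 < j \<and> norm (w j) \<le> norm (w 0)", OF ex] by (auto simp: m_def)
      have before: "norm (w 0) \<le> norm (w j)" if "j < m" for j
        using not_less_Least[of j "\<lambda>j. 0 < j \<and> norm (w j) \<le> norm (w 0)"] that
        unfolding m_def[symmetric] by (cases "j = 0") auto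
      have 1: "lam ^ m \<le> (\<Prod>i<m. df (w i))"
        by (rule B[rule_format, OF kicked_truncate[OF tame_imp_kicked[OF less.prems(1)] m(3)] m(1)])
          (use before m less.prems False bd[OF less.prems(1,3)] in auto)
      have 2: "lam ^ (n - m) \<le> (\<Prod>i<n - m. df (w (m + i)))"
        by (rule less.IH[OF _ tame_shift[OF less.prems(1) m(3)]]) (use m less.prems in auto)
      have "lam ^ n = lam ^ m * lam ^ (n - m)" using m by (simp flip: power_add)
      also have "\<dots> \<le> (\<Prod>i<m. df (w i)) * (\<Prod>i<n - m. df (w (m + i)))"
        by (rule mult_mono[OF 1 2]) (use lam in \<open>auto intro: prod_nonneg\<close>)
      finally show ?thesis using prod_split_at[OF m(3), of "\<lambda>i. df (w i)"] by simp
    qed simp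
  qed
  define C where "C = min 1 C2"
  have C: "0 < C" "C \<le> 1" "C \<le> C2" using C2 by (auto simp: C_def)
  have "C * lam ^ n \<le> (\<Prod>i<n. df (w i))"
    if ts: "tame_seq n w z" and pos: "\<forall>j<n. 0 < norm (w j)" and min: "\<forall>j<n. norm (w n) \<le> norm (w j)" for n w z
  proof -
    define m where "m = (LEAST j. j = n \<or> norm (w j) < e)"
    have m: "m \<le> n" "m = n \<or> norm (w m) < e"
      using LeastI[of "\<lambda>j. j = n \<or> norm (w j) < e" n] Least_le[of "\<lambda>j. j = n \<or> norm (w j) < e" n]
      by (auto simp: m_def)
    have before: "e \<le> norm (w j)" if "j < m" for j
      using not_less_Least[of j "\<lambda>j. j = n \<or> norm (w j) < e"] that unfolding m_def[symmetric] by auto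
    have 1: "C * lam ^ m \<le> (\<Prod>i<m. df (w i))"
    proof (cases "m = 0")
      case False
      have "C * lam ^ m \<le> C2 * lam ^ m" using C lam by (intro mult_right_mono) auto
      also have "\<dots> \<le> (\<Prod>i<m. df (w i))"
        by (rule A[rule_format, OF kicked_truncate[OF tame_imp_kicked[OF ts] m(1)]])
          (use False before m bd[OF ts min] in auto)
      finally show ?thesis .
    qed (use C in simp)
    have 2: "lam ^ (n - m) \<le> (\<Prod>i<n - m. df (w (m + i)))"
    proof (cases "m = n")
      case False
      show ?thesis
        by (rule chain[OF tame_shift[OF ts m(1)]]) (use m False pos min in auto)
    qed simp
    have "C * lam ^ n = (C * lam ^ m) * lam ^ (n - m)" using m by (simp flip: power_add)
    also have "\<dots> \<le> (\<Prod>i<m. df (w i)) * (\<Prod>i<n - m. df (w (m + i)))"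
      by (rule mult_mono[OF 1 2]) (use lam in \<open>auto intro: prod_nonneg\<close>)
    finally show ?thesis using prod_split_at[OF m(1), of "\<lambda>i. df (w i)"] by simp
  qed
  then show ?thesis using C(1) by blast
qed

text \<open>The mirror image of the previous chain.  Let \<open>m\<close> be the time after 0 when the orbit is closest to 0
  and \<open>s = |w m|\<close>.  Replacing \<open>w 0\<close> by \<open>s\<close> yields a kicked orbit that returns at time \<open>m\<close> to its initial distance
  from 0, so the product over the times before \<open>m\<close>, including the artificial factor at time 0, is at least
  \<open>lam ^ m\<close>.  That factor equals the one at time \<open>m\<close>, whence the product over the times \<open>1, ..., m\<close> is
  bounded below, and the argument continues from \<open>m\<close>.  The start \<open>w 0 = 0\<close> is the case of the critical orbit.\<close>

lemma after_closest_approach_bound: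
  assumes lam: "0 < lam" "lam < 1"
  shows "\<exists>C>0. \<forall>n w z. tame_seq n w z \<longrightarrow> 0 < n \<longrightarrow> (\<forall>j<n. norm (w 0) \<le> norm (w j)) \<longrightarrow>
    (\<forall>j. 0 < j \<and> j < n \<longrightarrow> 0 < norm (w j)) \<longrightarrow> C * lam ^ n \<le> (\<Prod>i<n - 1. df (w (Suc i)))"
proof -
  define R where "R = norm a + 3"
  have R: "1 \<le> R" "norm a + 3 \<le> R" by (auto simp: R_def)
  from return_bounds[OF R(1) lam] obtain e C2 where e: "0 < e" and C2: "0 < C2"
    and A: "\<forall>n w z. kicked_seq n w z \<longrightarrow> 0 < n \<longrightarrow> (\<forall>j<n. e \<le> norm (w j) \<and> norm (w j) \<le> R) \<longrightarrow>
       C2 * lam ^ n \<le> (\<Prod>i<n. df (w i))"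
    and B: "\<forall>n w z. kicked_seq n w z \<longrightarrow> 0 < n \<longrightarrow> (\<forall>j<n. norm (w 0) \<le> norm (w j) \<and> norm (w j) \<le> R) \<longrightarrow>
       0 < norm (w 0) \<longrightarrow> norm (w 0) < e \<longrightarrow> norm (w n) \<le> norm (w 0) \<longrightarrow>
       lam ^ n \<le> (\<Prod>i<n. df (w i))" by (elim exE conjE)
  define C where "C = min 1 C2"
  have C: "0 < C" "C \<le> 1" "C \<le> C2" using C2 by (auto simp: C_def)
  have bounded: "C * lam ^ n \<le> (\<Prod>i<n - 1. df (w (Suc i)))"
    if "tame_seq n w z" "0 < n" "\<forall>j<n. norm (w 0) \<le> norm (w j)"
      "\<forall>j. 0 < j \<and> j < n \<longrightarrow> 0 < norm (w j)" "\<forall>j<n. norm (w j) \<le> R" for n w z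
    using that
  proof (induction n arbitrary: w z rule: less_induct)
    case (less n)
    show ?case
    proof (cases "n = 1")
      case True
      then show ?thesis using C lam mult_mono[of C 1 lam 1] by simp
    next
      case False
      then have n: "1 < n" using less.prems by simp
      have "\<exists>m\<in>{1..<n}. \<forall>j\<in>{1..<n}. norm (w m) \<le> norm (w j)"
        using ex_min_if_finite[of "(\<lambda>j. norm (w j)) ` {1..<n}"] n by (fastforce simp: not_less)
      then obtain m where m: "0 < m" "m < n" and min: "\<And>j. 0 < j \<Longrightarrow> j < n \<Longrightarrow> norm (w m) \<le> norm (w j)"
        by (auto simp: Suc_le_eq)
      define s where "s = norm (w m)"
      have s: "0 < s" "norm (w 0) \<le> s" using less.prems m by (auto simp: s_def)
      show ?thesis
      proof (cases "e \<le> s")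
        case True
        have "C * lam ^ n \<le> C2 * lam ^ (n - 1)"
        proof (rule mult_mono[OF C(3)])
          show "lam ^ n \<le> lam ^ (n - 1)" using lam by (intro power_decreasing) auto
        qed (use C2 lam in auto)
        also have "\<dots> \<le> (\<Prod>i<n - 1. df (w (1 + i)))"
        proof (rule A[rule_format, OF tame_imp_kicked[OF tame_shift[OF less.prems(1), of 1]]])
          show "e \<le> norm (w (1 + j)) \<and> norm (w (1 + j)) \<le> R" if "j < n - 1" for j
          proof -
            have j: "1 + j < n" using that by linarith
            then have "s \<le> norm (w (1 + j))" using min[of "1 + j"] by (simp add: s_def)
            then show ?thesis using j True less.prems(5) by auto
          qed
        qed (use n in auto)
        finally show ?thesis by simp
      next
        case False
        define w' where "w' = w(0 := complex_of_real s)"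
        have w'0: "norm (w' 0) = s" using s by (simp add: w'_def)
        have w'S: "w' i = w i" if "0 < i" for i using that by (simp add: w'_def)
        have sd: "norm (w 0) ^ d \<le> s ^ d" using s by (intro power_mono) auto
        have ks: "kicked_seq m w' z"
          unfolding kicked_seq_def
        proof (intro conjI allI impI)
          show "0 \<le> z" "z \<le> 1" "z = 0 \<or> (\<forall>t. 2 * mu ^ t \<le> kappa * theta ^ t * crit_deriv d a t)"
            using less.prems(1) unfolding tame_seq_def by auto
        next
          fix i assume i: "i < m"
          have t: "norm (w (Suc i) - f (w i)) \<le> 2 * mu ^ i * z" "mu ^ i * z \<le> norm (w i) ^ d"
            using less.prems(1) i m unfolding tame_seq_def by auto
          show "mu ^ i * z \<le> norm (w' i) ^ d"
            using t(2) sd w'0 w'S[of i] by (cases "i = 0") auto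
          show "norm (w' (Suc i) - f (w' i)) \<le> (if i = 0 then 4 * norm (w' 0) ^ d else 2 * mu ^ i * z)"
          proof (cases "i = 0")
            case True
            have "w 1 - f (w' 0) = (w 1 - f (w 0)) + (w 0 ^ d - w' 0 ^ d)" by (simp add: unicrit_def)
            then have "norm (w 1 - f (w' 0)) \<le> norm (w 1 - f (w 0)) + norm (w 0 ^ d - w' 0 ^ d)"
              by (metis norm_triangle_ineq)
            also have "norm (w 0 ^ d - w' 0 ^ d) \<le> norm (w 0) ^ d + s ^ d"
              using norm_triangle_ineq4[of "w 0 ^ d" "w' 0 ^ d"] w'0 by (simp add: norm_power)
            also have "norm (w 1 - f (w 0)) \<le> 2 * norm (w 0) ^ d" using t True by simp
            finally have "norm (w 1 - f (w' 0)) \<le> 4 * s ^ d" using sd by linarith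
            then show ?thesis using True w'0 w'S[of 1] by simp
          next
            case False
            then show ?thesis using t w'S[of i] w'S[of "Suc i"] by simp
          qed
        qed
        have "lam ^ m \<le> (\<Prod>i<m. df (w' i))"
        proof (rule B[rule_format, OF ks m(1)])
          show "norm (w' 0) \<le> norm (w' j) \<and> norm (w' j) \<le> R" if "j < m" for j
            using that w'0 w'S[of j] min[of j] less.prems(5) m s_def by (cases "j = 0") auto
          show "0 < norm (w' 0)" "norm (w' 0) < e" using w'0 s False by auto
          show "norm (w' m) \<le> norm (w' 0)" using w'0 w'S[OF m(1)] by (simp add: s_def)
        qed
        also have "(\<Prod>i<m. df (w' i)) = (\<Prod>i<m. df (w (Suc i)))"
        proof -
          obtain k where k: "m = Suc k" using m by (cases m) auto
          have "(\<Prod>i<m. df (w' i)) = df (w' 0) * (\<Prod>i<k. df (w' (Suc i)))"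
            unfolding k by (rule prod.lessThan_Suc_shift)
          also have "\<dots> = df (w m) * (\<Prod>i<k. df (w (Suc i)))" using w'0 w'S by (simp add: s_def)
          also have "\<dots> = (\<Prod>i<m. df (w (Suc i)))" by (simp add: k)
          finally show ?thesis .
        qed
        finally have 1: "lam ^ m \<le> (\<Prod>i<m. df (w (Suc i)))" .
        have 2: "C * lam ^ (n - m) \<le> (\<Prod>i<n - m - 1. df (w (m + Suc i)))"
          by (rule less.IH[OF _ tame_shift[OF less.prems(1) less_imp_le[OF m(2)]]])
            (use m min less.prems in auto)
        have "C * lam ^ n = lam ^ m * (C * lam ^ (n - m))" using m by (simp flip: power_add)
        also have "\<dots> \<le> (\<Prod>i<m. df (w (Suc i))) * (\<Prod>i<n - m - 1. df (w (m + Suc i)))"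
          by (rule mult_mono[OF 1 2]) (use lam C in \<open>auto intro: prod_nonneg\<close>)
        also have "\<dots> = (\<Prod>i<n - 1. df (w (Suc i)))"
          using prod_split_at[of m "n - 1" "\<lambda>i. df (w (Suc i))"] m by (simp add: diff_commute)
        finally show ?thesis .
      qed
    qed
  qed
  have "C * lam ^ n \<le> (\<Prod>i<n - 1. df (w (Suc i)))"
    if ts: "tame_seq n w z" "0 < n" and min: "\<forall>j<n. norm (w 0) \<le> norm (w j)"
      and pos: "\<forall>j. 0 < j \<and> j < n \<longrightarrow> 0 < norm (w j)" for n w z
  proof -
    \<comment> \<open>Once the orbit leaves the disc of radius \<open>R\<close> it escapes, and all further factors are at least 1.\<close>
    define m where "m = (LEAST j. j = n \<or> R < norm (w j))"
    have m: "m \<le> n" "m = n \<or> R < norm (w m)"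
      using LeastI[of "\<lambda>j. j = n \<or> R < norm (w j)" n] Least_le[of "\<lambda>j. j = n \<or> R < norm (w j)" n]
      by (auto simp: m_def)
    have before: "norm (w j) \<le> R" if "j < m" for j
      using not_less_Least[of j "\<lambda>j. j = n \<or> R < norm (w j)"] that unfolding m_def[symmetric] by auto
    have after: "1 \<le> df (w j)" if "m \<le> j" "j < n" for j
    proof -
      have "R < norm (w m)" using m that by auto
      moreover from this have "norm (w m) \<le> norm (w j)" using escape_mono[OF ts(1) R(2), of m j] that by simp
      ultimately have "1 \<le> norm (w j)" using R by linarith
      then have "1 * 1 \<le> real d * norm (w j) ^ (d - 1)"
        using d2 by (intro mult_mono one_le_power) auto
      then show ?thesis by simp
    qed
    define k where "k = m - 1"
    have k: "k \<le> n - 1" using m by (simp add: k_def)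
    have "C * lam ^ n \<le> C * lam ^ m" using C lam m by (intro mult_left_mono power_decreasing) auto
    also have "\<dots> \<le> (\<Prod>i<k. df (w (Suc i)))"
    proof (cases "m = 0")
      case False
      show ?thesis unfolding k_def
        by (rule bounded[OF tame_truncate[OF ts(1) m(1)]]) (use False min pos m before in auto)
    qed (use C in \<open>simp add: k_def\<close>)
    also have "\<dots> * 1 \<le> (\<Prod>i<k. df (w (Suc i))) * (\<Prod>i<n - 1 - k. df (w (Suc (k + i))))"
    proof (rule mult_left_mono)
      show "1 \<le> (\<Prod>i<n - 1 - k. df (w (Suc (k + i))))"
        by (rule prod_ge_1, rule after) (auto simp: k_def)
    qed (auto intro: prod_nonneg)
    finally show ?thesis using prod_split_at[OF k, of "\<lambda>i. df (w (Suc i))"] by simp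
  qed
  then show ?thesis using C(1) by blast
qed

text \<open>The exact orbit of 0 starts at its closest approach, and the factors after time 0 are those of the critical
  value.\<close>

lemma critical_growth:
  assumes lam: "0 < lam" "lam < 1"
  shows "\<exists>C>0. \<forall>t. C * lam ^ t \<le> crit_deriv d a t"
proof -
  from after_closest_approach_bound[OF lam] obtain C where C: "0 < C" and
    bd: "\<forall>n w z. tame_seq n w z \<longrightarrow> 0 < n \<longrightarrow> (\<forall>j<n. norm (w 0) \<le> norm (w j)) \<longrightarrow>
    (\<forall>j. 0 < j \<and> j < n \<longrightarrow> 0 < norm (w j)) \<longrightarrow> C * lam ^ n \<le> (\<Prod>i<n - 1. df (w (Suc i)))"
    by (elim exE conjE)
  have S: "(f ^^ Suc i) 0 = (f ^^ i) a" for i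
    by (simp add: funpow_Suc_right f0 del: funpow.simps)
  have "C * lam * lam ^ t \<le> crit_deriv d a t" for t
  proof -
    have "C * lam ^ Suc t \<le> (\<Prod>i<Suc t - 1. df ((f ^^ Suc i) 0))"
    proof (rule bd[rule_format, where z = 0 and w = "\<lambda>i. (f ^^ i) 0" and n = "Suc t"])
      show "tame_seq (Suc t) (\<lambda>i. (f ^^ i) 0) 0" by (simp add: tame_seq_def)
      show "0 < norm ((f ^^ j) 0)" if "0 < j \<and> j < Suc t" for j
        using that critical_not_periodic[of "j - 1"] S[of "j - 1"] by simp
    qed auto
    then show ?thesis by (simp add: crit_deriv_def S mult_ac del: funpow.simps)
  qed
  then show ?thesis using C lam by (intro exI[of _ "C * lam"]) auto
qed

text \<open>Let \<open>m\<close> be a time when the orbit is closest to 0.  The part before \<open>m\<close> is bounded by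
  \<open>closest_return_bound\<close>, the part after \<open>m\<close> by \<open>after_closest_approach_bound\<close>; only the factor of time
  \<open>m\<close> itself remains.\<close>

lemma tame_derivative_bound:
  assumes lam: "0 < lam" "lam < 1"
  shows "\<exists>C>0. \<forall>n w z. tame_seq n w z \<longrightarrow> 0 < n \<longrightarrow> (\<forall>j<n. 0 < norm (w j)) \<longrightarrow>
    (\<exists>m<n. C * lam ^ n * norm (w m) ^ (d - 1) \<le> (\<Prod>i<n. df (w i)))"
proof -
  from closest_return_bound[OF lam] obtain C1 where C1: "0 < C1" and
    b1: "\<forall>n w z. tame_seq n w z \<longrightarrow> (\<forall>j<n. 0 < norm (w j)) \<longrightarrow> (\<forall>j<n. norm (w n) \<le> norm (w j)) \<longrightarrow>
    C1 * lam ^ n \<le> (\<Prod>i<n. df (w i))" by (elim exE conjE)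
  from after_closest_approach_bound[OF lam] obtain C2 where C2: "0 < C2" and
    b2: "\<forall>n w z. tame_seq n w z \<longrightarrow> 0 < n \<longrightarrow> (\<forall>j<n. norm (w 0) \<le> norm (w j)) \<longrightarrow>
    (\<forall>j. 0 < j \<and> j < n \<longrightarrow> 0 < norm (w j)) \<longrightarrow> C2 * lam ^ n \<le> (\<Prod>i<n - 1. df (w (Suc i)))"
    by (elim exE conjE)
  have "\<exists>m<n. C1 * C2 * lam ^ n * norm (w m) ^ (d - 1) \<le> (\<Prod>i<n. df (w i))"
    if ts: "tame_seq n w z" "0 < n" and pos: "\<forall>j<n. 0 < norm (w j)" for n w z
  proof -
    have "\<exists>m\<in>{..<n}. \<forall>j\<in>{..<n}. norm (w m) \<le> norm (w j)"
      using ex_min_if_finite[of "(\<lambda>j. norm (w j)) ` {..<n}"] ts(2) by (fastforce simp: not_less)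
    then obtain m where m: "m < n" and min: "\<And>j. j < n \<Longrightarrow> norm (w m) \<le> norm (w j)" by auto
    have 1: "C1 * lam ^ m \<le> (\<Prod>i<m. df (w i))"
      by (rule b1[rule_format, OF tame_truncate[OF ts(1) less_imp_le[OF m]]]) (use m min pos in auto)
    have 2: "C2 * lam ^ (n - m) \<le> (\<Prod>i<n - m - 1. df (w (m + Suc i)))"
      by (rule b2[rule_format, OF tame_shift[OF ts(1) less_imp_le[OF m]]]) (use m min pos in auto)
    define c where "c = norm (w m) ^ (d - 1)"
    have c0: "0 \<le> c" by (simp add: c_def)
    have cd: "c \<le> df (w m)" using c0 d2 mult_right_mono[of 1 "real d" c] by (simp add: c_def)
    have "C1 * C2 * lam ^ n * c = (C1 * lam ^ m) * (c * (C2 * lam ^ (n - m)))"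
      using m by (simp flip: power_add)
    also have "\<dots> \<le> (\<Prod>i<m. df (w i)) * (df (w m) * (\<Prod>i<n - m - 1. df (w (m + Suc i))))"
      by (rule mult_mono[OF 1 mult_mono[OF cd 2]]) (use lam C2 c0 in \<open>auto intro: prod_nonneg\<close>)
    also have "df (w m) * (\<Prod>i<n - m - 1. df (w (m + Suc i))) = (\<Prod>i<n - m. df (w (m + i)))"
    proof -
      obtain k where k: "n - m = Suc k" using m by (cases "n - m") auto
      show ?thesis unfolding k by (subst prod.lessThan_Suc_shift) simp
    qed
    finally show ?thesis using m prod_split_at[OF less_imp_le[OF m], of "\<lambda>i. df (w i)"]
      unfolding c_def by auto
  qed
  moreover have "0 < C1 * C2" using C1 C2 by simp
  ultimately show ?thesis by blast
qed

end

section \<open>The skew product\<close>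

text \<open>If \<open>w j = 0\<close>, tameness forces all errors to vanish, and \<open>w n = 0\<close> would make 0 a periodic point.\<close>

lemma (in perturbed_unicritical) tame_closest_return_nonzero:
  assumes ts: "tame_seq n w z" and j: "j < n" and min: "norm (w n) \<le> norm (w j)"
  shows "0 < norm (w j)"
proof (rule ccontr)
  assume "\<not> ?thesis"
  then have wj: "w j = 0" by simp
  have tame: "\<And>i. i < n \<Longrightarrow> norm (w (Suc i) - f (w i)) \<le> 2 * mu ^ i * z \<and> mu ^ i * z \<le> norm (w i) ^ d"
    and z: "0 \<le> z" using ts unfolding tame_seq_def by auto
  have "mu ^ j * z \<le> 0" using tame[OF j] wj d2 by (simp add: power_0_left)
  then have "z = 0" using z mu by (simp add: mult_le_0_iff power_le_zero_eq)
  have "w (j + i) = (f ^^ i) 0" if "j + i \<le> n" for i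
    using that
  proof (induction i)
    case (Suc i)
    then show ?case using tame[of "j + i"] \<open>z = 0\<close> by simp
  qed (simp add: wj)
  from this[of "n - j"] have "w n = (f ^^ (n - j)) 0" using j by simp
  moreover obtain k where "n - j = Suc k" using j by (cases "n - j") auto
  ultimately have "w n = (f ^^ k) a" by (simp add: funpow_Suc_right f0 del: funpow.simps)
  then show False using critical_not_periodic[of k] min wj by simp
qed

lemma skew_map_iterate_vertical_derivative:
  assumes hol: "c holomorphic_on ball 0 r0" and l: "norm l \<le> 1"
    and orb: "orbit_segment (skew_map l d c) n x" and x0: "norm (fst (x 0)) < r0"
  shows "\<exists>D. ((skew_map l d c ^^ n) has_derivative D) (at (x 0)) \<and>
    D (0, 1) = (0, \<Prod>i<n. of_nat d * snd (x i) ^ (d - 1)) \<and> (skew_map l d c ^^ n) (x 0) = x n \<and>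
    fst (x n) = l ^ n * fst (x 0)"
  using orb
proof (induction n)
  case 0
  have "((skew_map l d c ^^ 0) has_derivative (\<lambda>v. v)) (at (x 0))" by (simp add: id_def)
  then show ?case by (intro exI[of _ "\<lambda>v. v"]) simp
next
  case (Suc n)
  define F where "F = skew_map l d c"
  obtain D where D: "((F ^^ n) has_derivative D) (at (x 0))"
    "D (0, 1) = (0, \<Prod>i<n. of_nat d * snd (x i) ^ (d - 1))" "(F ^^ n) (x 0) = x n"
    "fst (x n) = l ^ n * fst (x 0)"
    using Suc unfolding orbit_segment_def F_def by auto
  have xS: "x (Suc n) = F (x n)" using Suc.prems by (simp add: orbit_segment_def F_def)
  define z where "z = fst (x n)"
  define w where "w = snd (x n)"
  have "norm z \<le> norm (fst (x 0))"
    unfolding z_def D(4) norm_mult norm_power using l by (intro mult_left_le_one_le power_le_one) auto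
  then have "z \<in> ball 0 r0" using x0 by simp
  then have "(c has_field_derivative deriv c z) (at z)"
    by (rule holomorphic_derivI[OF hol open_ball])
  then have c': "(c has_derivative (\<lambda>h. deriv c z * h)) (at (fst (x n)))"
    by (simp add: has_field_derivative_def z_def)
  have 1: "((\<lambda>p :: complex \<times> complex. l * fst p) has_derivative (\<lambda>h. l * fst h)) (at (x n))"
    by (rule has_derivative_mult_right[OF has_derivative_fst[OF has_derivative_ident]])
  have "((\<lambda>u. u ^ d) has_field_derivative of_nat d * w ^ (d - 1)) (at w)"
    by (auto intro!: derivative_eq_intros)
  then have "((\<lambda>u. u ^ d) has_derivative (\<lambda>h. of_nat d * w ^ (d - 1) * h)) (at (snd (x n)))"
    unfolding has_field_derivative_def w_def .
  from has_derivative_compose[OF has_derivative_snd[OF has_derivative_ident] this]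
  have 2: "((\<lambda>p :: complex \<times> complex. snd p ^ d) has_derivative (\<lambda>h. of_nat d * w ^ (d - 1) * snd h)) (at (x n))" .
  from has_derivative_compose[OF has_derivative_fst[OF has_derivative_ident] c']
  have 3: "((\<lambda>p :: complex \<times> complex. c (fst p)) has_derivative (\<lambda>h. deriv c z * fst h)) (at (x n))" .
  have "((\<lambda>p. (l * fst p, snd p ^ d + c (fst p))) has_derivative
      (\<lambda>h. (l * fst h, of_nat d * w ^ (d - 1) * snd h + deriv c z * fst h))) (at (x n))"
    by (rule has_derivative_Pair[OF 1 has_derivative_add[OF 2 3]])
  moreover have "F = (\<lambda>p. (l * fst p, snd p ^ d + c (fst p)))"
    by (auto simp: F_def skew_map_def)
  ultimately have "(F has_derivative (\<lambda>h. (l * fst h, of_nat d * w ^ (d - 1) * snd h + deriv c z * fst h)))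
      (at ((F ^^ n) (x 0)))" using D(3) by simp
  from diff_chain_at[OF D(1) this]
  have "((F ^^ Suc n) has_derivative ((\<lambda>h. (l * fst h, of_nat d * w ^ (d - 1) * snd h + deriv c z * fst h)) \<circ> D)) (at (x 0))"
    by simp
  moreover have "((\<lambda>h. (l * fst h, of_nat d * w ^ (d - 1) * snd h + deriv c z * fst h)) \<circ> D) (0, 1)
     = (0, \<Prod>i<Suc n. of_nat d * snd (x i) ^ (d - 1))"
    using D(2) by (simp add: w_def mult_ac)
  moreover have "(F ^^ Suc n) (x 0) = x (Suc n)" using D(3) xS by simp
  moreover have "fst (x (Suc n)) = l ^ Suc n * fst (x 0)"
    unfolding xS F_def skew_map_def using D(4) by (simp add: case_prod_unfold)
  ultimately show ?case unfolding F_def by blast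
qed

theorem theorem1p4:
  fixes l :: complex and d k :: nat and c :: "complex \<Rightarrow> complex" and r0 lam0 :: real
  assumes "0 < norm l" and "norm l < 1"
    and "d \<ge> 2"
    and "0 < r0" and "r0 < 1"
    and "c holomorphic_on ball 0 r0"
    and "k \<ge> 1"
    and "(\<lambda>z. c z - c 0 - z ^ k) \<in> O[at 0](\<lambda>z. z ^ (k + 1))"
    and "\<forall>z\<in>ball 0 r0. norm (c z - c 0 - z ^ k) \<le> norm (z ^ k)"
    and "\<not> has_attracting_cycle (\<lambda>w. w ^ d + c 0)"
    and "\<not> has_superattracting_cycle (\<lambda>w. w ^ d + c 0)"
    and "0 < lam0" and "lam0 < 1"
  shows "\<exists>C>0. \<forall>n\<ge>1. \<forall>x. tame_orbit r0 k d (skew_map l d c) n x \<longrightarrow>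
           norm (frechet_derivative (skew_map l d c ^^ n) (at (x 0)) (0, 1))
             \<ge> C * lam0 ^ n * (MIN i\<in>{0..n - 1}. norm (snd (x i)) ^ (d - 1)) \<and>
           ((\<forall>j<n. norm (snd (x n)) \<le> norm (snd (x j))) \<longrightarrow>
             norm (frechet_derivative (skew_map l d c ^^ n) (at (x 0)) (0, 1))
               \<ge> C * lam0 ^ n)"
proof -
  define a where "a = c 0"
  define mu where "mu = norm l ^ k"
  have mu: "0 < mu" "mu < 1" unfolding mu_def using assms(1,2,7) power_strict_decreasing[of 0 k "norm l"] by auto
  note mult = no_attracting_cycle_imp_multiplier_ge_1[OF assms(10,11), folded a_def]
  \<comment> \<open>Error-free orbits do not involve \<open>kappa\<close> and \<open>theta\<close>; 0 and \<open>1/2\<close> are arbitrary.  They yield growth of the critical orbit at the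
  rate \<open>sqrt mu\<close>, hence errors decay like \<open>sqrt mu ^ t\<close> relative to the derivative along it.\<close>
  interpret one_dim: perturbed_unicritical d a mu 0 "1/2"
    by standard (use assms(3) mult mu in auto)
  define th where "th = sqrt mu"
  have th: "0 < th" "th < 1" "th * th = mu" using mu by (auto simp: th_def)
  from one_dim.critical_growth[OF th(1,2)] obtain CF where CF: "0 < CF"
    and growth: "\<forall>t. CF * th ^ t \<le> crit_deriv d a t" by (elim exE conjE)
  interpret perturbed_unicritical d a mu "2 / CF" th
    by standard (use assms(3) mult mu CF th in auto)
  have kappa: "2 * mu ^ t \<le> 2 / CF * th ^ t * crit_deriv d a t" for t
  proof -
    have "2 * mu ^ t = 2 / CF * th ^ t * (CF * th ^ t)"
      using CF by (simp add: th(3)[symmetric] power_mult_distrib)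
    also have "\<dots> \<le> 2 / CF * th ^ t * crit_deriv d a t"
      using growth CF th by (intro mult_left_mono) auto
    finally show ?thesis .
  qed
  from tame_derivative_bound[OF assms(12,13)] obtain C1 where C1: "0 < C1" and
    b1: "\<forall>n w z. tame_seq n w z \<longrightarrow> 0 < n \<longrightarrow> (\<forall>j<n. 0 < norm (w j)) \<longrightarrow>
    (\<exists>m<n. C1 * lam0 ^ n * norm (w m) ^ (d - 1) \<le> (\<Prod>i<n. df (w i)))" by (elim exE conjE)
  from closest_return_bound[OF assms(12,13)] obtain C2 where C2: "0 < C2" and
    b2: "\<forall>n w z. tame_seq n w z \<longrightarrow> (\<forall>j<n. 0 < norm (w j)) \<longrightarrow> (\<forall>j<n. norm (w n) \<le> norm (w j)) \<longrightarrow>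
    C2 * lam0 ^ n \<le> (\<Prod>i<n. df (w i))" by (elim exE conjE)
  define C where "C = min C1 C2"
  have C: "0 < C" "C \<le> C1" "C \<le> C2" using C1 C2 by (auto simp: C_def)
  have "C * lam0 ^ n * (MIN i\<in>{0..n - 1}. norm (snd (x i)) ^ (d - 1))
          \<le> norm (frechet_derivative (skew_map l d c ^^ n) (at (x 0)) (0, 1)) \<and>
        ((\<forall>j<n. norm (snd (x n)) \<le> norm (snd (x j))) \<longrightarrow>
          C * lam0 ^ n \<le> norm (frechet_derivative (skew_map l d c ^^ n) (at (x 0)) (0, 1)))"
    if n: "1 \<le> n" and orb: "tame_orbit r0 k d (skew_map l d c) n x" for n x
  proof -
    define w where "w i = snd (x i)" for i
    define z where "z = norm (fst (x 0)) ^ k"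
    have os: "orbit_segment (skew_map l d c) i x" if "i \<le> n" for i
      using orb that unfolding tame_orbit_def orbit_segment_def by auto
    have x0: "norm (fst (x 0)) < r0" using orb unfolding tame_orbit_def by blast
    have l1: "norm l \<le> 1" using assms(2) by simp
    note vert = skew_map_iterate_vertical_derivative[OF assms(6) l1 os x0]
    have fst: "fst (x i) = l ^ i * fst (x 0)" if "i \<le> n" for i using vert[OF that] by blast
    have zi: "norm (fst (x i)) ^ k = mu ^ i * z" if "i \<le> n" for i
      unfolding fst[OF that] mu_def z_def norm_mult norm_power power_mult_distrib
      by (simp flip: power_mult add: mult.commute)
    obtain D where D: "((skew_map l d c ^^ n) has_derivative D) (at (x 0))"
      "D (0, 1) = (0, \<Prod>i<n. of_nat d * snd (x i) ^ (d - 1))"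
      using vert[of n] by blast
    have deriv: "norm (frechet_derivative (skew_map l d c ^^ n) (at (x 0)) (0, 1)) = (\<Prod>i<n. df (w i))"
      unfolding frechet_derivative_at[OF D(1), symmetric] D(2)
      by (simp add: norm_Pair w_def norm_mult norm_power abs_prod abs_mult flip: prod_norm)
    have ts: "tame_seq n w z"
      unfolding tame_seq_def
    proof (intro conjI allI impI)
      show "0 \<le> z" by (simp add: z_def)
      show "z \<le> 1" unfolding z_def using x0 assms(5) by (intro power_le_one) auto
      show "z = 0 \<or> (\<forall>t. 2 * mu ^ t \<le> 2 / CF * th ^ t * crit_deriv d a t)" using kappa by blast
    next
      fix i assume i: "i < n"
      show "mu ^ i * z \<le> norm (w i) ^ d"
        using orb i zi[of i] unfolding tame_orbit_def w_def by auto
      define y where "y = fst (x i)"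
      have "norm y \<le> norm (fst (x 0))"
        unfolding y_def fst[OF less_imp_le[OF i]] norm_mult norm_power
        using l1 by (intro mult_left_le_one_le power_le_one) auto
      then have "y \<in> ball 0 r0" using x0 by simp
      then have cy: "norm (c y - c 0 - y ^ k) \<le> norm (y ^ k)" using assms(9) by blast
      have "w (Suc i) = w i ^ d + c y"
        using orb i unfolding tame_orbit_def orbit_segment_def w_def y_def
        by (simp add: skew_map_def case_prod_unfold)
      then have "w (Suc i) - f (w i) = (c y - c 0 - y ^ k) + y ^ k" by (simp add: unicrit_def a_def)
      then have "norm (w (Suc i) - f (w i)) \<le> 2 * norm (y ^ k)"
        using norm_triangle_ineq[of "c y - c 0 - y ^ k" "y ^ k"] cy by simp
      also have "norm (y ^ k) = mu ^ i * z" using zi[of i] i by (simp add: norm_power y_def)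
      finally show "norm (w (Suc i) - f (w i)) \<le> 2 * mu ^ i * z" by simp
    qed
    have P0: "0 \<le> (\<Prod>i<n. df (w i))" by (intro prod_nonneg) auto
    have min_le: "(MIN i\<in>{0..n - 1}. norm (w i) ^ (d - 1)) \<le> norm (w m) ^ (d - 1)" if "m < n" for m
      using that by (intro Min_le) auto
    have lamn: "0 \<le> lam0 ^ n" using assms(12) by simp
    have "C * lam0 ^ n * (MIN i\<in>{0..n - 1}. norm (w i) ^ (d - 1)) \<le> (\<Prod>i<n. df (w i))"
    proof (cases "\<forall>j<n. 0 < norm (w j)")
      case True
      then obtain m where m: "m < n" "C1 * lam0 ^ n * norm (w m) ^ (d - 1) \<le> (\<Prod>i<n. df (w i))"
        using b1[rule_format, OF ts] n by auto
      have "C * lam0 ^ n * (MIN i\<in>{0..n - 1}. norm (w i) ^ (d - 1)) \<le> C * lam0 ^ n * norm (w m) ^ (d - 1)"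
        using min_le[OF m(1)] C lamn by (intro mult_left_mono) auto
      also have "\<dots> \<le> C1 * lam0 ^ n * norm (w m) ^ (d - 1)"
        using C lamn by (intro mult_right_mono) auto
      finally show ?thesis using m(2) by linarith
    next
      case False
      then obtain j where j: "j < n" "w j = 0" by auto
      have "(MIN i\<in>{0..n - 1}. norm (w i) ^ (d - 1)) \<le> 0"
        using min_le[OF j(1)] j(2) assms(3) by (simp add: power_0_left)
      then have "C * lam0 ^ n * (MIN i\<in>{0..n - 1}. norm (w i) ^ (d - 1)) \<le> 0"
        using C lamn by (intro mult_nonneg_nonpos) auto
      then show ?thesis using P0 by linarith
    qed
    moreover have "C * lam0 ^ n \<le> (\<Prod>i<n. df (w i))" if min: "\<forall>j<n. norm (w n) \<le> norm (w j)"
    proof -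
      have "C * lam0 ^ n \<le> C2 * lam0 ^ n" using C lamn by (intro mult_right_mono) auto
      also have "\<dots> \<le> (\<Prod>i<n. df (w i))"
        by (rule b2[rule_format, OF ts]) (use tame_closest_return_nonzero[OF ts] min in auto)
      finally show ?thesis .
    qed
    ultimately show ?thesis unfolding deriv w_def by blast
  qed
  then show ?thesis using C(1) by blast
qed

end
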